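(* Let $m\ge 1$ and $n\ge 1$ be integers, let $A\in\mathbb{R}^{n\times n}$ and $C_i\in\mathbb{R}^{s_i\times n}$, $i\in\{1,\dots,m\}$, and consider the $m$-channel system $$\dot x = Ax,\qquad y_i = C_i x,\quad i\in\{1,\dots,m\},\qquad x\in\mathbb{R}^n.$$ Assume that $C_i\neq 0$ for every $i$, that the system is jointly observable (i.e. with $C=\begin{bmatrix}C_1^\top & \cdots & C_m^\top\end{bmatrix}^\top$ the pair $(C,A)$ is observable), and that the neighbor graph $\mathbb{N}$ is strongly connected. Then for every set $\Lambda$ of $mn+m-1$ complex numbers (counted with multiplicity) that is symmetric, i.e. closed under complex conjugation, there exists a distributed observer $$\dot z_i=\sum_{j\in\mathcal{N}_i}\big(H_{ij}z_j+K_{ij}y_j\big),\qquad x_i=\sum_{j\in\mathcal{N}_i}\big(M_{ij}z_j+N_{ij}y_j\big),\qquad i\in\{1,\dots,m\},$$ with $z_i\in\mathbb{R}^{n_i}$ and $\sum_i n_i=mn+m-1$, such that the spectrum of the $(mn+m-1)\times(mn+m-1)$ block matrix $H=[H_{ij}]$ (with $H_{ij}=0$ whenever $j\notin\mathcal{N}_i$) is exactly $\Lambda$. Moreover, for every initialization of $x$ and of the $z_i$, each estimation error $e_i(t)=x_i(t)-x(t)$, $i\in\{1,\dots,m\}$, converges to zero as $t\to\infty$ as fast as $e^{Ht}$ converges to zero (i.e. there is a constant $c$, depending on the initialization, with $\|e_i(t)\|\le c\,\|e^{Ht}\|$ for all $t\ge 0$).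
   Context: There are $m$ agents labeled $1,\dots,m$. For each $i$, $\mathcal{N}_i\subseteq\{1,\dots,m\}$ is the set of neighbors of agent $i$, and $i\in\mathcal{N}_i$. The neighbor graph $\mathbb{N}$ is the directed graph on vertices $\{1,\dots,m\}$ with an arc from $j$ to $i$ whenever $j\in\mathcal{N}_i$ and $j\neq i$. Agent $i$ measures $y_i$ and receives $z_j$ and $y_j$ from each neighbor $j\in\mathcal{N}_i$. The matrices $H_{ij},K_{ij},M_{ij},N_{ij}$ are constant real matrices of compatible dimensions. *)

theory Defs
  imports "HOL-Analysis.Analysis" "Jordan_Normal_Form.Char_Poly"
begin

section \<open>Block matrices with variable block sizes\<close>

definition offs :: "(nat \<Rightarrow> nat) \<Rightarrow> nat \<Rightarrow> nat" where
  "offs d i = (\<Sum>k<i. d k)"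

definition blk :: "(nat \<Rightarrow> nat) \<Rightarrow> nat \<Rightarrow> nat" where
  "blk d r = (LEAST i. r < offs d (Suc i))"

text \<open>Block matrix with p x q blocks; block (i,j) is B i j of size rd i x cd j.\<close>
definition block_mat ::
  "(nat \<Rightarrow> nat) \<Rightarrow> (nat \<Rightarrow> nat) \<Rightarrow> nat \<Rightarrow> nat \<Rightarrow> (nat \<Rightarrow> nat \<Rightarrow> 'a mat) \<Rightarrow> 'a mat" where
  "block_mat rd cd p q B =
     mat (offs rd p) (offs cd q)
       (\<lambda>(r, c). B (blk rd r) (blk cd c) $$ (r - offs rd (blk rd r), c - offs cd (blk cd c)))"

section \<open>Observability, graphs\<close>

definition observable :: "real mat \<Rightarrow> real mat \<Rightarrow> bool" where
  "observable C A \<longleftrightarrow>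
     (\<forall>v \<in> carrier_vec (dim_col A).
        (\<forall>k < dim_col A. C * (A ^\<^sub>m k) *\<^sub>v v = 0\<^sub>v (dim_row C)) \<longrightarrow> v = 0\<^sub>v (dim_col A))"

text \<open>Arcs of the neighbor graph on agents 0..m-1: arc j \<rightarrow> i iff j \<in> Nb i, j \<noteq> i.\<close>
definition nb_arcs :: "nat \<Rightarrow> (nat \<Rightarrow> nat set) \<Rightarrow> (nat \<times> nat) set" where
  "nb_arcs m Nb = {(j, i). i < m \<and> j < m \<and> j \<in> Nb i \<and> j \<noteq> i}"

definition strongly_connected :: "nat \<Rightarrow> (nat \<Rightarrow> nat set) \<Rightarrow> bool" where
  "strongly_connected m Nb \<longleftrightarrow> (\<forall>i < m. \<forall>j < m. (i, j) \<in> (nb_arcs m Nb)\<^sup>*)"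

section \<open>Vectors, norms, ODEs, matrix exponential\<close>

definition vsum :: "nat \<Rightarrow> (nat \<Rightarrow> real vec) \<Rightarrow> nat set \<Rightarrow> real vec" where
  "vsum d f J = vec d (\<lambda>k. \<Sum>j\<in>J. f j $ k)"

definition vnorm :: "real vec \<Rightarrow> real" where
  "vnorm v = sqrt (\<Sum>k<dim_vec v. (v $ k)\<^sup>2)"

text \<open>Frobenius norm (all matrix norms are equivalent up to constants).\<close>
definition mnorm :: "real mat \<Rightarrow> real" where
  "mnorm M = sqrt (\<Sum>r<dim_row M. \<Sum>c<dim_col M. (M $$ (r, c))\<^sup>2)"

text \<open>x has derivative x' at t within S (componentwise), x t of dimension d.\<close>
definition has_vec_deriv :: "nat \<Rightarrow> (real \<Rightarrow> real vec) \<Rightarrow> real vec \<Rightarrow> real \<Rightarrow> real set \<Rightarrow> bool" where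
  "has_vec_deriv d x x' t S \<longleftrightarrow>
     (\<forall>k < d. ((\<lambda>s. x s $ k) has_real_derivative (x' $ k)) (at t within S))"

definition mat_exp :: "real \<Rightarrow> real mat \<Rightarrow> real mat" where
  "mat_exp t H = mat (dim_row H) (dim_col H)
     (\<lambda>(r, c). \<Sum>k. (t ^ k / fact k) * ((H ^\<^sub>m k) $$ (r, c)))"

end

theory Submission
  imports Defs "HOL-Library.Function_Algebras"
begin

text \<open>
Agent i is given states estimating row functionals \<open>T i k\<close> of x. If every
\<open>(T i k) A - (H T) i k\<close> is a combination of output rows of neighbors of i, the errors
\<open>z - T x\<close> obey the autonomous equation with matrix H; and if the functionals of agent i together
with the rows of \<open>C i\<close> span everything, agent i can read off x. So all the work lies in choosing T
and H with the prescribed spectrum.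

Fix a root q. In a gathering phase along an in-tree towards q, agent i learns the smallest
A-invariant space \<open>K i\<close> of functionals containing its own output rows and the spaces of its
predecessors. Since everything these supply is measured, \<open>K i\<close> has a basis
\<open>t 0, t 1, \<dots>\<close> starting with a nonzero row of \<open>C i\<close> such that \<open>(t k) A = t (k + 1)\<close>
up to measured terms, ending in 0; a companion matrix with arbitrary first column is then an
admissible diagonal block. Joint observability says that \<open>K q\<close> is everything. In a relaying phase
along an out-tree from q, the remaining functionals are passed on to the other agents; since all
their derivatives are known to the parent, the diagonal block is entirely free. Ordered by phase
and tree level, H is block triangular, so its characteristic polynomial is the product of those of
the companion blocks.

A real block of odd size needs a real eigenvalue. A gathering block of odd size is therefore
shrunk by one (a reduced-order observer, using that the nonzero row of \<open>C i\<close> is measured), and a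
relaying block of odd size is enlarged by one. The \<open>m - 1\<close> spare dimensions pay for
this, with the surplus put into a single autonomous block at q, and a symmetric multiset splits into
symmetric parts of given sizes if at most one of these is odd.
\<close>

section \<open>Determinants over finite index sets\<close>

text \<open>The Leibniz formula over an arbitrary finite index set. Block matrices can then be
  indexed by pairs (agent, local index), and submatrices are obtained by restricting the
  set.\<close>

definition fdet :: "'a set \<Rightarrow> ('a \<Rightarrow> 'a \<Rightarrow> 'b::comm_ring_1) \<Rightarrow> 'b" where
  "fdet S M = (\<Sum>p | p permutes S. of_int (sign p) * (\<Prod>x\<in>S. M x (p x)))"

lemma fdet_empty [simp]: "fdet {} M = 1"
  by (simp add: fdet_def)

lemma fdet_cong:
  assumes "\<And>x y. x \<in> S \<Longrightarrow> y \<in> S \<Longrightarrow> M x y = M' x y"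
  shows "fdet S M = fdet S M'"
  unfolding fdet_def
  by (intro sum.cong refl arg_cong2[of _ _ _ _ "(*)"] prod.cong)
     (use assms in \<open>auto simp: permutes_in_image\<close>)

lemma det_eq_fdet:
  assumes "A \<in> carrier_mat n n"
  shows "det A = fdet {..<n} (\<lambda>i j. A $$ (i, j))"
  using det_def'[OF assms] by (simp add: fdet_def atLeast0LessThan)

text \<open>Transporting permutations along \<open>f\<close> is a bijection that preserves signs, so
  the Leibniz sums agree term by term.\<close>

lemma fdet_reindex:
  assumes f: "inj_on f S" and fin: "finite S"
  shows "fdet (f ` S) M = fdet S (\<lambda>x y. M (f x) (f y))"
proof -
  have bij: "bij_betw f S (f ` S)" using f by (simp add: bij_betw_def)
  have sgn: "sign (map_permutation S f p) = sign p" if "p permutes S" for p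
    using that f fin by (simp add: sign_map_permutation)
  have "bij_betw (map_permutation S f) {p. p permutes S} {p. p permutes f ` S}"
  proof -
    have eq: "map_permutation S f p = (\<lambda>x. if x \<in> f ` S then f (p (inv_into S f x)) else x)" for p
      by (auto simp: map_permutation_def restrict_id_def fun_eq_iff)
    show ?thesis using bij_betw_permutations[OF bij] by (simp add: eq[abs_def])
  qed
  then show ?thesis
    unfolding fdet_def
    by (subst sum.reindex_bij_betw[symmetric])
       (auto intro!: sum.cong simp: sgn prod.reindex[OF f] map_permutation_apply[OF f])
qed

lemma permutes_restrict:
  assumes "p permutes S" "A \<subseteq> S" "p ` A \<subseteq> A" "finite S"
  shows "(\<lambda>x. if x \<in> A then p x else x) permutes A"
proof (rule bij_imp_permutes)
  have inj: "inj_on p A" using permutes_inj[OF assms(1)] by (auto simp: inj_on_def)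
  have "p ` A = A"
    using assms by (meson endo_inj_surj finite_subset inj)
  then have "bij_betw p A A" using inj by (simp add: bij_betw_def)
  then show "bij_betw (\<lambda>x. if x \<in> A then p x else x) A A"
    by (subst bij_betw_cong[where g = p]) auto
qed auto

text \<open>An injective self-map of the finite set \<open>A\<close> is onto \<open>A\<close>, so no
  point of \<open>B\<close> can also be sent there.\<close>

lemma permutes_image_complement:
  assumes r: "r permutes A \<union> B" "r ` A \<subseteq> A" and fin: "finite A" and disj: "A \<inter> B = {}"
  shows "r ` B \<subseteq> B"
proof safe
  fix x assume x: "x \<in> B"
  show "r x \<in> B"
  proof (rule ccontr)
    assume "r x \<notin> B"
    then have "r x \<in> A" using r x by (metis UnE UnI2 permutes_in_image)
    moreover have "r ` A = A"
      using r fin permutes_inj[OF r(1)] by (intro endo_inj_surj) (auto simp: inj_on_def)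
    ultimately obtain y where "y \<in> A" "r y = r x" by (metis imageE)
    then show False using permutes_inj[OF r(1)] x disj by (auto simp: inj_def)
  qed
qed

text \<open>A permutation that moves some point of \<open>A\<close> into \<open>B\<close> picks up a
  vanishing factor. The remaining ones split uniquely into a permutation of \<open>A\<close> and one
  of \<open>B\<close>, with multiplicative sign.\<close>

lemma fdet_block_triangular:
  assumes fin: "finite A" "finite B" and disj: "A \<inter> B = {}"
    and zero: "\<And>x y. x \<in> A \<Longrightarrow> y \<in> B \<Longrightarrow> M x y = 0"
  shows "fdet (A \<union> B) M = fdet A M * fdet B M"
proof -
  let ?S = "A \<union> B"
  let ?P = "{p. p permutes ?S \<and> p ` A \<subseteq> A}"
  let ?t = "\<lambda>S p. of_int (sign p) * (\<Prod>x\<in>S. M x (p x))"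
  have "fdet ?S M = sum (?t ?S) ?P"
    unfolding fdet_def
  proof (rule sum.mono_neutral_right)
    show "finite {p. p permutes ?S}" using fin by (simp add: finite_permutations)
    show "\<forall>p\<in>{p. p permutes ?S} - ?P. ?t ?S p = 0"
    proof
      fix p assume p: "p \<in> {p. p permutes ?S} - ?P"
      then obtain x where x: "x \<in> A" "p x \<notin> A" by auto
      then have "p x \<in> B" using p by (auto dest: permutes_in_image[of _ _ x])
      then have "(\<Prod>x\<in>?S. M x (p x)) = 0"
        using x zero fin by (intro prod_zero) auto
      then show "?t ?S p = 0" by simp
    qed
  qed auto
  also have "\<dots> = (\<Sum>(p, q)\<in>{p. p permutes A} \<times> {q. q permutes B}. ?t A p * ?t B q)"
  \<comment> \<open>Splitting restricts \<open>r\<close> to \<open>A\<close> and to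
    \<open>B\<close>, extended by the identity; merging composes. The five cases are: merging undoes
    splitting, the split lies in the product, splitting undoes merging, the merge preserves
    \<open>A\<close>, and the summands agree.\<close>
  proof (rule sum.reindex_bij_witness[where
        i = "\<lambda>(p, q). p \<circ> q" and
        j = "\<lambda>r. (\<lambda>x. if x \<in> A then r x else x, \<lambda>x. if x \<in> B then r x else x)"], goal_cases)
    case (1 r)
    then have r: "r permutes ?S" "r ` A \<subseteq> A" by auto
    have "r ` B \<subseteq> B" by (rule permutes_image_complement[OF r fin(1) disj])
    then show ?case using disj r permutes_not_in[OF r(1)] by (auto simp: fun_eq_iff)
  next
    case (2 r)
    then have r: "r permutes ?S" "r ` A \<subseteq> A" by auto
    have rB: "r ` B \<subseteq> B" by (rule permutes_image_complement[OF r fin(1) disj])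
    show ?case
      using permutes_restrict[OF r(1) _ r(2)] permutes_restrict[OF r(1) _ rB] fin by auto
  next
    case (3 b)
    then obtain p q where b: "b = (p, q)" "p permutes A" "q permutes B" by auto
    have A: "(p \<circ> q) x = p x" if "x \<in> A" for x
    proof -
      have "x \<notin> B" using that disj by auto
      then show ?thesis by (simp add: permutes_not_in[OF b(3)])
    qed
    have B: "(p \<circ> q) x = q x" if "x \<in> B" for x
    proof -
      have "q x \<in> B" using permutes_in_image[OF b(3)] that by blast
      then have "q x \<notin> A" using disj by auto
      then show ?thesis by (simp add: permutes_not_in[OF b(2)])
    qed
    have "(\<lambda>x. if x \<in> A then (p \<circ> q) x else x) = p"
      using A permutes_not_in[OF b(2)] by (intro ext) (simp del: o_apply)
    moreover have "(\<lambda>x. if x \<in> B then (p \<circ> q) x else x) = q"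
      using B permutes_not_in[OF b(3)] by (intro ext) (simp del: o_apply)
    ultimately show ?case by (simp only: b(1) prod.case)
  next
    case (4 b)
    then obtain p q where b: "b = (p, q)" "p permutes A" "q permutes B" by auto
    have "p permutes ?S" "q permutes ?S" using b(2,3) by (auto intro: permutes_subset)
    then have "p \<circ> q permutes ?S" by (rule permutes_compose[rotated])
    moreover have "(p \<circ> q) x \<in> A" if "x \<in> A" for x
    proof -
      have "x \<notin> B" using that disj by auto
      then show ?thesis using permutes_in_image[OF b(2)] that by (simp add: permutes_not_in[OF b(3)])
    qed
    ultimately show ?case using b by auto
  next
    case (5 r)
    then have r: "r permutes ?S" "r ` A \<subseteq> A" by auto
    have rB: "r ` B \<subseteq> B" by (rule permutes_image_complement[OF r fin(1) disj])
    define p q where "p = (\<lambda>x. if x \<in> A then r x else x)" "q = (\<lambda>x. if x \<in> B then r x else x)"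
    have pq: "p permutes A" "q permutes B"
      unfolding p_q_def
      using permutes_restrict[OF r(1) _ r(2)] permutes_restrict[OF r(1) _ rB] fin by auto
    have rpq: "r = p \<circ> q"
      using rB disj permutes_not_in[OF r(1)] by (auto simp: fun_eq_iff p_q_def)
    have "sign r = sign p * sign q"
      unfolding rpq using pq fin by (intro sign_compose) (auto simp: permutation_permutes)
    moreover have "(\<Prod>x\<in>?S. M x (r x)) = (\<Prod>x\<in>A. M x (p x)) * (\<Prod>x\<in>B. M x (q x))"
      by (subst prod.union_disjoint[OF fin disj]) (simp add: p_q_def)
    ultimately show ?case by (simp add: p_q_def)
  qed
  also have "\<dots> = fdet A M * fdet B M"
    by (simp add: fdet_def sum_product sum.cartesian_product)
  finally show ?thesis .
qed

text \<open>Induction on the largest level: its columns vanish in all rows of lower level, so it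
  splits off as a diagonal block. Levels of \<open>L\<close> that do not occur give empty blocks,
  whose determinant is 1.\<close>

lemma fdet_levels:
  fixes lev :: "'a \<Rightarrow> nat"
  assumes fin: "finite S" and L: "finite L" "lev ` S \<subseteq> L"
    and tri: "\<And>x y. x \<in> S \<Longrightarrow> y \<in> S \<Longrightarrow> lev x < lev y \<Longrightarrow> M x y = 0"
  shows "fdet S M = (\<Prod>v\<in>L. fdet {x\<in>S. lev x = v} M)"
  using L fin tri
proof (induction L arbitrary: S rule: finite_linorder_max_induct)
  case (insert b L)
  let ?A = "{x\<in>S. lev x \<noteq> b}" and ?B = "{x\<in>S. lev x = b}"
  have "fdet (?A \<union> ?B) M = fdet ?A M * fdet ?B M"
  proof (rule fdet_block_triangular)
    fix x y assume xy: "x \<in> ?A" "y \<in> ?B"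
    then have "lev x \<in> L" using insert.prems by auto
    then show "M x y = 0" using xy insert.hyps insert.prems(3)[of x y] by auto
  qed (use insert.prems in auto)
  moreover have "?A \<union> ?B = S" by auto
  moreover have "fdet ?A M = (\<Prod>v\<in>L. fdet {x\<in>?A. lev x = v} M)"
    using insert.prems by (intro insert.IH) auto
  moreover have "\<dots> = (\<Prod>v\<in>L. fdet {x\<in>S. lev x = v} M)"
    using insert.hyps by (intro prod.cong refl arg_cong2[of _ _ _ _ fdet]) auto
  ultimately show ?case using insert.hyps by (subst prod.insert) (auto simp: mult.commute)
qed auto

section \<open>Companion blocks and symmetric spectra\<close>

text \<open>Ones above the diagonal carry each chain vector to the next; the free first column is an
  injection of the zeroth vector of the chain.\<close>

definition companion :: "(nat \<Rightarrow> 'a::ring_1) \<Rightarrow> nat \<Rightarrow> nat \<Rightarrow> 'a" where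
  "companion \<beta> k l = (if l = 0 then \<beta> k else 0) + (if l = Suc k then 1 else 0)"

text \<open>Expansion along the last row gives the recursion: multiply the previous polynomial by
  the variable and subtract the new constant \<open>\<beta> e\<close>.\<close>

lemma fdet_companion:
  fixes \<beta> :: "nat \<Rightarrow> 'a::comm_ring_1"
  shows "fdet {..<e} (\<lambda>k l. (if k = l then [:0, 1:] else 0) - [:companion \<beta> k l:])
    = monom 1 e - (\<Sum>k<e. monom (\<beta> k) (e - 1 - k))"
proof (induction e)
  case (Suc e)
  let ?M = "\<lambda>k l. (if k = l then [:0, 1:] else 0) - [:companion \<beta> k l:]"
  let ?A = "\<lambda>d. mat d d (\<lambda>(k, l). ?M k l)"
  have det: "fdet {..<d} ?M = det (?A d)" for d
    by (subst det_eq_fdet[of _ d]) (auto intro: fdet_cong)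
  \<comment> \<open>For \<open>e = 0\<close> both summands sit on the single entry. The cofactors
    \<open>corner\<close> and \<open>first\<close> then coincide, so splitting the expansion into
    two deltas stays correct.\<close>
  have last: "?A (Suc e) $$ (e, j) = (if j = e then [:0, 1:] else 0) + (if j = 0 then [:- \<beta> e:] else 0)"
    if "j < Suc e" for j
    using that by (auto simp: companion_def)
  have "mat_delete (?A (Suc e)) e e = ?A e"
    by (intro eq_matI) (auto simp: mat_delete_def)
  then have corner: "cofactor (?A (Suc e)) e e = det (?A e)"
    by (simp add: cofactor_def)
  \<comment> \<open>Without the first column the entries -1 above the diagonal become the diagonal,
    and the variable appears only below it. The resulting sign is cancelled by the sign of the
    cofactor.\<close>
  have del: "mat_delete (?A (Suc e)) e 0 = mat e e (\<lambda>(i, j). (if i = Suc j then [:0, 1:] else 0) - (if i = j then 1 else 0))"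
    by (intro eq_matI) (auto simp: mat_delete_def companion_def one_pCons)
  have diag: "diag_mat (mat_delete (?A (Suc e)) e 0) = replicate e (- 1)"
    unfolding del by (intro nth_equalityI) (auto simp: diag_mat_def)
  have "det (mat_delete (?A (Suc e)) e 0) = (-1) ^ e"
    by (subst det_lower_triangular[where n = e], unfold diag prod_list_replicate) (auto simp: del)
  then have first: "cofactor (?A (Suc e)) e 0 = 1"
    by (simp add: cofactor_def flip: power_add mult_2)
  have "det (?A (Suc e)) = (\<Sum>j<Suc e. ?A (Suc e) $$ (e, j) * cofactor (?A (Suc e)) e j)"
    by (rule laplace_expansion_row[where n = "Suc e"]) auto
  also have "\<dots> = (\<Sum>j<Suc e. (if j = e then [:0, 1:] * det (?A e) else 0) + (if j = 0 then [:- \<beta> e:] else 0))"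
    by (intro sum.cong refl) (auto simp: last corner first simp del: index_mat)
  also have "\<dots> = [:0, 1:] * det (?A e) + [:- \<beta> e:]"
    by (simp only: sum.distrib sum.delta finite_lessThan) simp
  also have "\<dots> = [:0, 1:] * (monom 1 e - (\<Sum>k<e. monom (\<beta> k) (e - 1 - k))) - monom (\<beta> e) 0"
    using Suc.IH by (simp add: det monom_0)
  also have "\<dots> = monom 1 (Suc e) - (\<Sum>k<Suc e. monom (\<beta> k) (Suc e - 1 - k))"
  proof -
    have "[:0, 1:] * (\<Sum>k<e. monom (\<beta> k) (e - 1 - k)) = (\<Sum>k<e. monom (\<beta> k) (e - k))"
      unfolding sum_distrib_left
      by (intro sum.cong refl) (auto simp flip: monom_Suc simp: Suc_diff_Suc)
    moreover have "[:0, 1:] * monom (1::'a) e = monom 1 (Suc e)" by (simp flip: monom_Suc)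
    ultimately show ?thesis by (simp add: right_diff_distrib del: mult_pCons_left)
  qed
  finally show ?case by (simp add: det)
qed simp

section \<open>Conjugation-symmetric root multisets and real companion blocks\<close>

lemma coeff_prod_roots_cnj:
  "coeff (\<Prod>a\<in>#image_mset cnj L. [:- a, 1:]) i = cnj (coeff (\<Prod>a\<in>#L. [:- a, 1:]) i)"
  by (induction L arbitrary: i) (auto simp: coeff_pCons split: nat.splits)

lemma degree_prod_roots: "degree (\<Prod>a\<in>#L. [:- a, 1 :: complex:]) = size L"
  and lead_coeff_prod_roots: "lead_coeff (\<Prod>a\<in>#L. [:- a, 1 :: complex:]) = 1"
proof -
  have "degree (\<Prod>a\<in>#L. [:- a, 1 :: complex:]) = size L
    \<and> lead_coeff (\<Prod>a\<in>#L. [:- a, 1 :: complex:]) = 1"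
  proof (induction L)
    case (add a L)
    let ?p = "\<Prod>a\<in>#L. [:- a, 1 :: complex:]"
    have "?p \<noteq> 0" using add.IH by auto
    then have "degree ([:- a, 1:] * ?p) = Suc (degree ?p)"
      by (subst degree_mult_eq) auto
    moreover have "lead_coeff ([:- a, 1:] * ?p) = 1"
      by (subst lead_coeff_mult) (use add.IH in auto)
    ultimately show ?case using add.IH by (simp del: mult_pCons_left)
  qed auto
  then show "degree (\<Prod>a\<in>#L. [:- a, 1 :: complex:]) = size L"
    "lead_coeff (\<Prod>a\<in>#L. [:- a, 1 :: complex:]) = 1" by auto
qed

text \<open>Symmetry of the roots makes the coefficients of the monic polynomial real, and a
  companion block realizes every real monic polynomial.\<close>

lemma symmetric_roots_companion:
  assumes sym: "image_mset cnj L = L"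
  shows "\<exists>\<beta>. fdet {..<size L} (\<lambda>k l. (if k = l then [:0, 1:] else 0) - [:complex_of_real (companion \<beta> k l):])
      = (\<Prod>a\<in>#L. [:- a, 1:])"
proof -
  let ?p = "\<Prod>a\<in>#L. [:- a, 1:]" and ?e = "size L"
  \<comment> \<open>The first column lists the negated coefficients from the highest exponent below
    the leading one down to the constant, as in \<open>fdet_companion\<close>. Taking real parts
    loses nothing, by \<open>re\<close> below.\<close>
  define \<beta> where "\<beta> k = - Re (coeff ?p (?e - 1 - k))" for k
  have "cnj (coeff ?p i) = coeff ?p i" for i
    using coeff_prod_roots_cnj[of L i] sym by simp
  then have re: "complex_of_real (Re (coeff ?p i)) = coeff ?p i" for i
    by (metis Reals_cnj_iff of_real_Re)
  have "?p = (\<Sum>i\<le>?e. monom (coeff ?p i) i)"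
    using poly_as_sum_of_monoms[of ?p] by (simp add: degree_prod_roots)
  also have "\<dots> = (\<Sum>i<?e. monom (coeff ?p i) i) + monom 1 ?e"
    using lead_coeff_prod_roots[of L] by (simp add: degree_prod_roots flip: lessThan_Suc_atMost)
  also have "(\<Sum>i<?e. monom (coeff ?p i) i) = (\<Sum>k<?e. monom (coeff ?p (?e - 1 - k)) (?e - 1 - k))"
    using sum.nat_diff_reindex[of "\<lambda>i. monom (coeff ?p i) i" ?e] by simp
  also have "\<dots> = - (\<Sum>k<?e. monom (complex_of_real (\<beta> k)) (?e - 1 - k))"
    by (simp add: \<beta>_def re minus_monom flip: sum_negf)
  finally have p: "?p = monom 1 ?e - (\<Sum>k<?e. monom (complex_of_real (\<beta> k)) (?e - 1 - k))" by simp
  have "complex_of_real (companion \<beta> k l) = companion (\<lambda>k. complex_of_real (\<beta> k)) k l" for k l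
    by (simp add: companion_def)
  then show ?thesis using p fdet_companion[of ?e "\<lambda>k. complex_of_real (\<beta> k)"]
    by (intro exI[of _ \<beta>]) simp
qed

text \<open>A nonreal element brings its conjugate along; if there is none, any two elements will
  do.\<close>

lemma symmetric_pair_submset:
  assumes sym: "image_mset cnj L = L" and size: "size L \<ge> 2"
  obtains P where "P \<subseteq># L" "image_mset cnj P = P" "size P = 2"
proof (cases "\<exists>a\<in>#L. cnj a \<noteq> a")
  case True
  then obtain a where a: "a \<in># L" "cnj a \<noteq> a" by blast
  then have "cnj a \<in># L" using sym by (metis image_eqI set_image_mset)
  then have "{#a, cnj a#} \<subseteq># L" using a
    by (metis insert_DiffM insert_noteq_member mset_subset_eq_add_mset_cancel single_subset_iff)
  then show ?thesis by (rule that) (auto simp: add_mset_commute)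
next
  case False
  obtain a L' where a: "L = add_mset a L'" using size by (cases L) auto
  obtain b L'' where b: "L' = add_mset b L''" using size a by (cases L') auto
  show ?thesis by (rule that[of "{#a, b#}"]) (use False a b in auto)
qed

text \<open>Pairs are removed one after another; what is left stays symmetric.\<close>

lemma symmetric_even_submset:
  assumes sym: "image_mset cnj L = L" and "even d" "d \<le> size L"
  obtains P where "P \<subseteq># L" "image_mset cnj P = P" "size P = d"
proof -
  have "\<exists>P. P \<subseteq># L \<and> image_mset cnj P = P \<and> size P = 2 * k" if "2 * k \<le> size L" for k
    using that
  proof (induction k)
    case (Suc k)
    then obtain P where P: "P \<subseteq># L" "image_mset cnj P = P" "size P = 2 * k" by auto
    have "image_mset cnj (L - P) = L - P" using P sym by (simp add: image_mset_Diff)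
    moreover have "size (L - P) \<ge> 2" using P Suc.prems by (simp add: size_Diff_submset)
    ultimately obtain Q where Q: "Q \<subseteq># L - P" "image_mset cnj Q = Q" "size Q = 2"
      by (rule symmetric_pair_submset)
    have "P + Q \<subseteq># L" using P(1) Q(1)
      by (metis add.commute subset_eq_diff_conv subset_mset.le_diff_conv2)
    then show ?case using P Q by (intro exI[of _ "P + Q"]) auto
  qed auto
  then show ?thesis using assms that by (metis evenE)
qed

lemma image_mset_sum: "image_mset f (\<Sum>b\<in>C. F b) = (\<Sum>b\<in>C. image_mset f (F b))"
  by (induction C rule: infinite_finite_induct) auto

text \<open>The even parts are cut off one by one and \<open>b0\<close> receives the rest. Only the
  part at \<open>b0\<close> may be odd, and no condition on it is required because a symmetric
  multiset minus symmetric parts is symmetric.\<close>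

lemma symmetric_mset_partition:
  assumes sym: "image_mset cnj L = L" and fin: "finite B" and b0: "b0 \<in> B"
    and size: "sum d B = size L" and even: "\<And>b. b \<in> B \<Longrightarrow> b \<noteq> b0 \<Longrightarrow> even (d b)"
  shows "\<exists>F. (\<forall>b\<in>B. image_mset cnj (F b) = F b \<and> size (F b) = d b) \<and> (\<Sum>b\<in>B. F b) = L"
proof -
  have "\<exists>F. (\<forall>b\<in>C. image_mset cnj (F b) = F b \<and> size (F b) = d b) \<and> (\<Sum>b\<in>C. F b) \<subseteq># L"
    if "finite C" "C \<subseteq> B - {b0}" for C
    using that
  proof (induction C rule: finite_induct)
    case (insert c C)
    then obtain F where F: "\<And>b. b \<in> C \<Longrightarrow> image_mset cnj (F b) = F b" "\<And>b. b \<in> C \<Longrightarrow> size (F b) = d b"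
      "(\<Sum>b\<in>C. F b) \<subseteq># L" by auto
    have symF: "image_mset cnj (\<Sum>b\<in>C. F b) = (\<Sum>b\<in>C. F b)"
      unfolding image_mset_sum using F by (intro sum.cong) auto
    have sizeF: "size (\<Sum>b\<in>C. F b) = sum d C"
      using F by (simp add: size_multiset_sum)
    have "sum d (insert c C) \<le> sum d B" using insert.prems fin by (intro sum_mono2) auto
    then have "d c \<le> size (L - (\<Sum>b\<in>C. F b))"
      using insert.hyps by (simp only: size_Diff_submset[OF F(3)] sizeF flip: size) simp
    moreover have "image_mset cnj (L - (\<Sum>b\<in>C. F b)) = L - (\<Sum>b\<in>C. F b)"
      using F(3) sym symF by (simp add: image_mset_Diff)
    moreover have "even (d c)" using even insert.prems by auto
    ultimately obtain P where P: "P \<subseteq># L - (\<Sum>b\<in>C. F b)" "image_mset cnj P = P" "size P = d c"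
      using symmetric_even_submset by metis
    have PL: "P + (\<Sum>b\<in>C. F b) \<subseteq># L" using P(1) F(3)
      by (metis subset_eq_diff_conv subset_mset.le_diff_conv2)
    have "(\<Sum>b\<in>C. (F(c := P)) b) = (\<Sum>b\<in>C. F b)"
      using insert.hyps by (intro sum.cong) auto
    then show ?case using insert.hyps P PL F
      by (intro exI[of _ "F(c := P)"]) auto
  qed auto
  from this[of "B - {b0}"] fin obtain F where
    F: "\<And>b. b \<in> B - {b0} \<Longrightarrow> image_mset cnj (F b) = F b \<and> size (F b) = d b"
      "(\<Sum>b\<in>B - {b0}. F b) \<subseteq># L" by auto
  let ?R = "L - (\<Sum>b\<in>B - {b0}. F b)"
  have symF: "image_mset cnj (\<Sum>b\<in>B - {b0}. F b) = (\<Sum>b\<in>B - {b0}. F b)"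
    unfolding image_mset_sum using F by (intro sum.cong) auto
  have sizeF: "size (\<Sum>b\<in>B - {b0}. F b) = sum d (B - {b0})"
    using F by (simp add: size_multiset_sum)
  have "sum d B = d b0 + sum d (B - {b0})" by (rule sum.remove[OF fin b0])
  then have "size ?R = d b0"
    by (simp only: size_Diff_submset[OF F(2)] sizeF flip: size)
  moreover have "image_mset cnj ?R = ?R" using F(2) sym symF by (simp add: image_mset_Diff)
  moreover have "(\<Sum>b\<in>B. (F(b0 := ?R)) b) = L"
  proof -
    have "(\<Sum>b\<in>B. (F(b0 := ?R)) b) = ?R + (\<Sum>b\<in>B - {b0}. F b)"
      by (subst sum.remove[OF fin b0]) (auto intro!: sum.cong)
    then show ?thesis using F(2) by (simp add: subset_mset.diff_add)
  qed
  ultimately show ?thesis using F by (intro exI[of _ "F(b0 := ?R)"]) auto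
qed

section \<open>Chains of functionals\<close>

text \<open>Makes \<open>nat \<Rightarrow> real\<close> a real vector space, in which row
  functionals of every length live. This space has infinite dimension, so later statements carry a
  finite set \<open>B\<close> whose span contains all spaces concerned.\<close>

instantiation "fun" :: (type, real_vector) real_vector
begin

definition "scaleR_fun r f = (\<lambda>x. r *\<^sub>R f x)"

instance
  by standard (auto simp: scaleR_fun_def fun_eq_iff algebra_simps)

end

lemma scaleR_fun_apply [simp]: "(r *\<^sub>R f) x = r *\<^sub>R f x"
  by (simp add: scaleR_fun_def)

text \<open>Coefficients belong to indices rather than to vectors, so \<open>f\<close> may repeat
  values, for instance several zero functionals.\<close>

lemma span_image_sum:
  fixes f :: "'i \<Rightarrow> 'v::real_vector"
  assumes "finite I" "v \<in> span (f ` I)"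
  shows "\<exists>\<kappa>. v = (\<Sum>i\<in>I. \<kappa> i *\<^sub>R f i)"
  using assms
proof (induction I arbitrary: v rule: finite_induct)
  case (insert j I)
  then obtain r where "v - r *\<^sub>R f j \<in> span (f ` I)" by (auto simp: span_breakdown_eq)
  then obtain \<kappa> where \<kappa>: "v - r *\<^sub>R f j = (\<Sum>i\<in>I. \<kappa> i *\<^sub>R f i)"
    using insert.IH by blast
  have "(\<Sum>i\<in>insert j I. (\<kappa>(j := r)) i *\<^sub>R f i) = r *\<^sub>R f j + (\<Sum>i\<in>I. \<kappa> i *\<^sub>R f i)"
    using insert.hyps by (auto intro!: sum.cong)
  then show ?case using \<kappa> by (intro exI[of _ "\<kappa>(j := r)"]) (simp add: algebra_simps)
qed auto

text \<open>A longest admissible chain works. Each vector is the image of its predecessor corrected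
  by an element of \<open>Q\<close>, and the correction is chosen so as to keep independence while
  the span is not yet \<open>K\<close>.\<close>

lemma krylov_basis:
  fixes a :: "'v::real_vector \<Rightarrow> 'v"
  assumes lin: "linear a" and Q: "subspace Q" "Q \<subseteq> K" and K: "subspace K" "a ` K \<subseteq> K"
    and fin: "finite B" "K \<subseteq> span B"
    and min: "\<forall>U. subspace U \<and> Q \<subseteq> U \<and> a ` U \<subseteq> U \<longrightarrow> K \<subseteq> U"
    and c: "c \<in> Q" "c \<noteq> 0"
  obtains v N where "v 0 = c" "N > 0" "\<And>k. Suc k < N \<Longrightarrow> a (v k) - v (Suc k) \<in> Q"
    "span (v ` {..<N}) = K" "dim K = N"
proof -
  define P where "P N v \<longleftrightarrow> v 0 = c \<and> (\<forall>k. Suc k < N \<longrightarrow> a (v k) - v (Suc k) \<in> Q)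
    \<and> inj_on v {..<N} \<and> independent (v ` {..<N}) \<and> v ` {..<N} \<subseteq> K \<and> N > 0" for N v
  \<comment> \<open>Independence inside \<open>span B\<close> bounds the length, so a longest chain
    exists.\<close>
  have bound: "N \<le> card B" if "P N v" for N v
  proof -
    have "card (v ` {..<N}) \<le> card B"
      using that fin by (intro independent_span_bound[THEN conjunct2]) (auto simp: P_def)
    then show ?thesis using that by (simp add: P_def card_image)
  qed
  have step: "\<exists>v'. P (Suc N) v'" if PN: "P N v" and ne: "span (v ` {..<N}) \<noteq> K" for N v
  proof -
    let ?V = "span (v ` {..<N})"
    have N: "N > 0" and vK: "v ` {..<N} \<subseteq> K" using PN by (auto simp: P_def)
    have VK: "?V \<subseteq> K" using K(1) vK by (simp add: span_minimal)
    have last: "v (N - 1) \<in> K" using vK N by auto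
    have "\<exists>q\<in>Q. a (v (N - 1)) + q \<notin> ?V"
    proof (rule ccontr)
      assume "\<not> ?thesis"
      then have all: "\<And>q. q \<in> Q \<Longrightarrow> a (v (N - 1)) + q \<in> ?V" by auto
      \<comment> \<open>If no correction leads out of the span, \<open>q = 0\<close> puts the image
        of the last vector into it. Subtracting that image from its corrected versions puts all of
        \<open>Q\<close> there too. The span is then invariant, and minimality of \<open>K\<close>
        makes it all of \<open>K\<close>.\<close>
      have av: "a (v (N - 1)) \<in> ?V" using all[of 0] subspace_0[OF Q(1)] by simp
      have QV: "Q \<subseteq> ?V"
        using all av by (metis add_diff_cancel_left' span_diff subsetI)
      have "a (v k) \<in> ?V" if "k < N" for k
      proof (cases "Suc k < N")
        case True
        then have "a (v k) - v (Suc k) \<in> ?V" using PN QV by (auto simp: P_def)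
        moreover have "v (Suc k) \<in> ?V" using True by (auto intro: span_base)
        ultimately show ?thesis using span_add by fastforce
      next
        case False
        then have "k = N - 1" using that by simp
        then show ?thesis using av by simp
      qed
      then have "a ` (v ` {..<N}) \<subseteq> ?V" by auto
      then have "a ` ?V \<subseteq> ?V"
        by (metis linear_span_image[OF lin] span_minimal subspace_span)
      then have "K \<subseteq> ?V" using min QV by simp
      then show False using VK ne by auto
    qed
    then obtain q where q: "q \<in> Q" "a (v (N - 1)) + q \<notin> ?V" by blast
    let ?w = "a (v (N - 1)) + q"
    have im: "(v(N := ?w)) ` {..<Suc N} = insert ?w (v ` {..<N})"
      by (auto simp: lessThan_Suc)
    have "P (Suc N) (v(N := ?w))"
      unfolding P_def im
    proof (intro conjI allI impI)
      show "(v(N := ?w)) 0 = c" using PN N by (simp add: P_def)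
      fix k assume k: "Suc k < Suc N"
      show "a ((v(N := ?w)) k) - (v(N := ?w)) (Suc k) \<in> Q"
      proof (cases "Suc k = N")
        case True
        then show ?thesis using q subspace_neg[OF Q(1)] by auto
      next
        case False
        then show ?thesis using k PN by (simp add: P_def)
      qed
    next
      have "?w \<notin> v ` {..<N}" using q(2) span_base[of ?w "v ` {..<N}"] by auto
      then have "\<forall>x<N. v x \<noteq> ?w" by (metis imageI lessThan_iff)
      then show "inj_on (v(N := ?w)) {..<Suc N}"
        using PN by (auto simp: P_def lessThan_Suc inj_on_def)
      show "independent (insert ?w (v ` {..<N}))"
        using PN q(2) by (simp add: P_def independent_insertI)
      have "?w \<in> K" using K last q(1) Q(2) by (auto intro!: subspace_add)
      then show "insert ?w (v ` {..<N}) \<subseteq> K" using vK by auto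
    qed auto
    then show ?thesis by blast
  qed
  have "P 1 (\<lambda>_. c)" using c Q by (auto simp: P_def inj_on_def lessThan_Suc dependent_single)
  then have "\<exists>v. P 1 v" by blast
  moreover have "{N. \<exists>v. P N v} \<subseteq> {..card B}" using bound by auto
  then have finP: "finite {N. \<exists>v. P N v}" by (rule finite_subset) simp
  ultimately obtain N where N: "\<exists>v. P N v" "\<And>N'. \<exists>v. P N' v \<Longrightarrow> N' \<le> N"
    using Max_in[OF finP] Max_ge[OF finP] by blast
  then obtain v where v: "P N v" by blast
  have sp: "span (v ` {..<N}) = K"
    using step[OF v] N(2)[of "Suc N"] by auto
  have "dim K = N"
    using v unfolding sp[symmetric] dim_span by (simp add: P_def dim_eq_card_independent card_image)
  then show ?thesis using v sp by (intro that[of v N]) (auto simp: P_def)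
qed

text \<open>The last image of a Krylov chain is a combination of the chain. Passing to the Horner
  vectors of that relation turns the last image into 0 modulo \<open>Q\<close>, at the price of
  multiples of \<open>c\<close>, which lie in \<open>Q\<close>.\<close>

lemma measured_chain:
  fixes a :: "'v::real_vector \<Rightarrow> 'v"
  assumes lin: "linear a" and Q: "subspace Q" "Q \<subseteq> K" and K: "subspace K" "a ` K \<subseteq> K"
    and fin: "finite B" "K \<subseteq> span B"
    and min: "\<forall>U. subspace U \<and> Q \<subseteq> U \<and> a ` U \<subseteq> U \<longrightarrow> K \<subseteq> U"
    and c: "c \<in> Q" "c \<noteq> 0"
  obtains t where "t 0 = c" "\<And>k. k < dim K \<Longrightarrow> a (t k) - t (Suc k) \<in> Q" "t (dim K) = 0"
    "span (t ` {..<dim K}) = K" "dim K > 0"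
proof -
  obtain v N where v: "v 0 = c" "N > 0" "\<And>k. Suc k < N \<Longrightarrow> a (v k) - v (Suc k) \<in> Q"
    "span (v ` {..<N}) = K" "dim K = N"
    using krylov_basis[OF assms] by blast
  \<comment> \<open>One further vector is appended, the exact image of the last one, so that the
    relation defining \<open>\<alpha>\<close> can be written as \<open>w N\<close>.\<close>
  define w where "w k = (if k < N then v k else a (v (N - 1)))" for k
  have w0: "w 0 = c" using v by (simp add: w_def)
  have wN: "w ` {..<N} = v ` {..<N}" by (auto simp: w_def)
  have wstep: "a (w k) - w (Suc k) \<in> Q" if "k < N" for k
  proof (cases "Suc k < N")
    case False
    then have "k = N - 1" using that by simp
    then show ?thesis using False that subspace_0[OF Q(1)] by (simp add: w_def)
  qed (use v(3) in \<open>simp add: w_def\<close>)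
  have "v (N - 1) \<in> span (v ` {..<N})" by (rule span_base) (use v(2) in auto)
  then have "v (N - 1) \<in> K" by (simp add: v(4))
  then have "w N \<in> span (w ` {..<N})" using K(2) by (auto simp: w_def wN v(4))
  then obtain \<alpha> where \<alpha>: "w N = (\<Sum>j<N. \<alpha> j *\<^sub>R w j)"
    using span_image_sum[of "{..<N}" "w N" w] by auto
  \<comment> \<open>These are the Horner partial polynomials of x^N - sum of
    \<open>\<alpha> j\<close> x^j, with the powers x^j replaced by \<open>w j\<close>; the full
    polynomial gives \<open>t N = 0\<close>.\<close>
  define t where "t k = w k - (\<Sum>i<k. \<alpha> (N - 1 - i) *\<^sub>R w (k - 1 - i))" for k
  have t0: "t 0 = c" by (simp add: t_def w0)
  have tN: "t N = 0"
    using sum.nat_diff_reindex[of "\<lambda>i. \<alpha> i *\<^sub>R w i" N] by (simp add: t_def \<alpha>)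
  have tstep: "a (t k) - t (Suc k) \<in> Q" if "k < N" for k
  proof -
    have "a (t k) = a (w k) - (\<Sum>i<k. \<alpha> (N - 1 - i) *\<^sub>R a (w (k - 1 - i)))"
      by (simp add: t_def linear_diff[OF lin] linear_sum[OF lin] linear_scale[OF lin])
    \<comment> \<open>The summand with \<open>i = k\<close> is split off. It is the multiple of
      \<open>w 0 = c\<close> by which the Horner recursion differs from applying
      \<open>a\<close>.\<close>
    moreover have "t (Suc k) = w (Suc k) - (\<Sum>i<k. \<alpha> (N - 1 - i) *\<^sub>R w (Suc (k - 1 - i)))
        - \<alpha> (N - 1 - k) *\<^sub>R w 0"
      by (simp add: t_def Suc_diff_Suc)
    ultimately have "a (t k) - t (Suc k) = (a (w k) - w (Suc k))
        - (\<Sum>i<k. \<alpha> (N - 1 - i) *\<^sub>R (a (w (k - 1 - i)) - w (Suc (k - 1 - i))))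
        + \<alpha> (N - 1 - k) *\<^sub>R w 0"
      by (simp add: algebra_simps sum_subtractf)
    also have "\<dots> \<in> Q"
    proof (rule subspace_add[OF Q(1) subspace_diff[OF Q(1) wstep[OF that]]])
      show "(\<Sum>i<k. \<alpha> (N - 1 - i) *\<^sub>R (a (w (k - 1 - i)) - w (Suc (k - 1 - i)))) \<in> Q"
        using that by (intro subspace_sum subspace_scale Q(1) wstep) auto
      show "\<alpha> (N - 1 - k) *\<^sub>R w 0 \<in> Q" using c(1) by (simp add: w0 subspace_scale Q(1))
    qed
    finally show ?thesis .
  qed
  \<comment> \<open>The passage from \<open>w\<close> to \<open>t\<close> is unitriangular, hence
    invertible on spans.\<close>
  have "w k \<in> span (t ` {..<N})" if "k < N" for k
    using that
  proof (induction k rule: less_induct)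
    case (less k)
    have "w k = t k + (\<Sum>i<k. \<alpha> (N - 1 - i) *\<^sub>R w (k - 1 - i))" by (simp add: t_def)
    also have "\<dots> \<in> span (t ` {..<N})"
      using less by (intro span_add span_sum span_scale) (auto intro: span_base)
    finally show ?case .
  qed
  then have "span (w ` {..<N}) \<subseteq> span (t ` {..<N})" by (intro span_minimal) auto
  moreover have "t k \<in> span (w ` {..<N})" if "k < N" for k
    unfolding t_def using that
    by (intro span_diff span_sum span_scale) (auto intro: span_base)
  then have "span (t ` {..<N}) \<subseteq> span (w ` {..<N})" by (intro span_minimal) auto
  ultimately have "span (t ` {..<N}) = K" by (simp add: wN v(4))
  then show ?thesis using t0 tN tstep v(2,5) by (intro that[of t]) auto
qed

section \<open>Observer cells of even size and the completion by further functionals\<close>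

lemma sum_companion_scaleR:
  fixes u :: "nat \<Rightarrow> 'v::real_vector"
  assumes "k < e"
  shows "(\<Sum>l<e. companion \<beta> k l *\<^sub>R u l) = \<beta> k *\<^sub>R u 0 + (if Suc k < e then u (Suc k) else 0)"
proof -
  have "(\<Sum>l<e. companion \<beta> k l *\<^sub>R u l)
      = (\<Sum>l<e. (if l = 0 then \<beta> k *\<^sub>R u l else 0) + (if l = Suc k then u l else 0))"
    by (intro sum.cong) (auto simp: companion_def algebra_simps)
  then show ?thesis using assms by (auto simp: sum.distrib)
qed

text \<open>If the dimension of K is odd, a reduced-order observer saves the directly measured
  functional c, so the cell can always be given even size.\<close>
lemma even_observer_cell:
  fixes a :: "'v::real_vector \<Rightarrow> 'v"
  assumes lin: "linear a" and Q: "subspace Q" "Q \<subseteq> K" and K: "subspace K" "a ` K \<subseteq> K"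
    and fin: "finite B" "K \<subseteq> span B"
    and min: "\<forall>U. subspace U \<and> Q \<subseteq> U \<and> a ` U \<subseteq> U \<longrightarrow> K \<subseteq> U"
    and c: "c \<in> Q" "c \<noteq> 0" and e: "e = 2 * (dim K div 2)"
  shows "\<exists>u. (\<forall>k<e. a (u k) - (\<Sum>l<e. companion \<beta> k l *\<^sub>R u l) \<in> Q) \<and> span (insert c (u ` {..<e})) = K"
proof -
  obtain t where t: "t 0 = c" "\<And>k. k < dim K \<Longrightarrow> a (t k) - t (Suc k) \<in> Q" "t (dim K) = 0"
    "span (t ` {..<dim K}) = K" "dim K > 0"
    using measured_chain[OF lin Q K fin min c] by metis
  have tK: "t k \<in> K" if "k < dim K" for k
  proof -
    have "t k \<in> span (t ` {..<dim K})" by (rule span_base) (use that in auto)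
    then show ?thesis by (simp add: t(4))
  qed
  have cK: "c \<in> K" using c Q by auto
  show ?thesis
  proof (cases "even (dim K)")
    case True
    then have eN: "e = dim K" using e by simp
    show ?thesis
    proof (rule exI[of _ t], intro conjI allI impI)
      fix k assume k: "k < e"
      \<comment> \<open>In the last row the missing successor may be written as
        \<open>t (Suc k)\<close>, because \<open>t (dim K) = 0\<close>.\<close>
      have "(\<Sum>l<e. companion \<beta> k l *\<^sub>R t l) = \<beta> k *\<^sub>R c + t (Suc k)"
        using k t(3) by (subst sum_companion_scaleR) (auto simp: t(1) eN dest!: not_less_eq[THEN iffD2] less_antisym)
      then have eq: "a (t k) - (\<Sum>l<e. companion \<beta> k l *\<^sub>R t l) = (a (t k) - t (Suc k)) - \<beta> k *\<^sub>R c"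
        by (simp add: algebra_simps)
      show "a (t k) - (\<Sum>l<e. companion \<beta> k l *\<^sub>R t l) \<in> Q"
        unfolding eq
        by (rule subspace_diff[OF Q(1) t(2) subspace_scale[OF Q(1) c(1)]]) (use k eN in simp)
    next
      have "c \<in> t ` {..<e}" using t(1,5) by (auto simp: eN)
      then show "span (insert c (t ` {..<e})) = K" by (simp add: insert_absorb eN t(4))
    qed
  next
    case False
    then have eN: "dim K = Suc e" using e by presburger
    \<comment> \<open>Reduced-order observer: \<open>t 0 = c\<close> is dropped as a state. With the
      shift by \<open>\<beta> k *\<^sub>R c\<close>, the term \<open>\<beta> k *\<^sub>R t 1\<close>
      coming from the image of \<open>c\<close> cancels against the first column times
      \<open>?u 0\<close>, and only elements of \<open>Q\<close> remain.\<close>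
    let ?u = "\<lambda>k. t (Suc k) + \<beta> k *\<^sub>R c"
    show ?thesis
    proof (rule exI[of _ ?u], intro conjI allI impI)
      fix k assume k: "k < e"
      have ne: "t (Suc (Suc k)) = 0" if "\<not> Suc k < e"
      proof -
        have "Suc (Suc k) = dim K" using k that eN by simp
        then show ?thesis using t(3) by simp
      qed
      have "a (?u k) - (\<Sum>l<e. companion \<beta> k l *\<^sub>R ?u l)
          = (a (t (Suc k)) - t (Suc (Suc k))) + \<beta> k *\<^sub>R (a (t 0) - t (Suc 0))
            - \<beta> k *\<^sub>R \<beta> 0 *\<^sub>R c - (if Suc k < e then \<beta> (Suc k) *\<^sub>R c else 0)"
        using k t(3) ne
        by (subst sum_companion_scaleR)
           (auto simp: linear_add[OF lin] linear_scale[OF lin] t(1) eN algebra_simps)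
      also have "\<dots> \<in> Q"
      proof -
        have "a (t (Suc k)) - t (Suc (Suc k)) \<in> Q" "a (t 0) - t (Suc 0) \<in> Q"
          using k eN t(2) by auto
        then show ?thesis
          by (auto intro!: subspace_add[OF Q(1)] subspace_diff[OF Q(1) subspace_diff[OF Q(1)]]
              subspace_scale[OF Q(1)] c(1) subspace_0[OF Q(1)] subspace_diff[OF Q(1)] simp del: scaleR_scaleR)
      qed
      finally show "a (?u k) - (\<Sum>l<e. companion \<beta> k l *\<^sub>R ?u l) \<in> Q" .
    next
      let ?S = "span (insert c (?u ` {..<e}))"
      have "t k \<in> ?S" if "k < Suc e" for k
      proof (cases k)
        case 0
        then show ?thesis using t(1) by (auto intro: span_base)
      next
        case (Suc j)
        then have "?u j \<in> ?S" using that by (auto intro: span_base)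
        moreover have "\<beta> j *\<^sub>R c \<in> ?S" by (auto intro: span_base span_scale)
        ultimately have "?u j - \<beta> j *\<^sub>R c \<in> ?S" by (rule span_diff)
        then show ?thesis using Suc by simp
      qed
      then have "t ` {..<dim K} \<subseteq> ?S" by (auto simp: eN)
      then have "span (t ` {..<dim K}) \<subseteq> ?S" by (rule span_minimal) simp
      then have "K \<subseteq> ?S" by (simp only: t(4))
      moreover have "?S \<subseteq> K"
        using tK cK by (intro span_minimal K(1)) (auto simp: eN intro!: subspace_add subspace_scale K(1))
      ultimately show "?S = K" by auto
    qed
  qed
qed

text \<open>A basis of \<open>K\<close> is extended to one of \<open>W\<close>. Slots of
  \<open>u\<close> beyond the new basis vectors hold 0, which leaves room to round \<open>f\<close>
  up.\<close>

lemma complete_functionals: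
  fixes K W :: "'v::real_vector set"
  assumes K: "subspace K" "K \<subseteq> W" and W: "subspace W" "W \<subseteq> span B" "finite B"
    and f: "dim W \<le> dim K + f"
  shows "\<exists>u. (\<forall>k. u k \<in> W) \<and> span (K \<union> u ` {..<f}) = W"
proof -
  obtain B1 where B1: "B1 \<subseteq> K" "independent B1" "K \<subseteq> span B1" "card B1 = dim K"
    using basis_exists[of K] by blast
  obtain B2 where B2: "B1 \<subseteq> B2" "B2 \<subseteq> W" "independent B2" "W \<subseteq> span B2"
    using maximal_independent_subset_extend[of B1 W] B1 K by blast
  have fin: "finite B2" using independent_span_bound[OF W(3) B2(3)] B2(2) W(2) by auto
  have "card B2 = dim W"
    using B2 by (metis basis_card_eq_dim)
  then have "card (B2 - B1) \<le> f"
    using f B1(4) B2(1) fin by (simp add: card_Diff_subset finite_subset)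
  then obtain g :: "nat \<Rightarrow> 'v" where g: "g ` {..<card (B2 - B1)} = B2 - B1"
    using fin ex_bij_betw_nat_finite[of "B2 - B1"] by (metis atLeast0LessThan bij_betw_def finite_Diff)
  define u where "u k = (if k < card (B2 - B1) then g k else 0)" for k
  have uW: "u k \<in> W" for k
    using g B2(2) subspace_0[OF W(1)] by (auto simp: u_def)
  have sub: "B2 \<subseteq> K \<union> u ` {..<f}"
  proof
    fix b assume b: "b \<in> B2"
    show "b \<in> K \<union> u ` {..<f}"
    proof (cases "b \<in> B1")
      case False
      then obtain k where "k < card (B2 - B1)" "g k = b" using g b by (metis DiffI imageE lessThan_iff)
      then show ?thesis using \<open>card (B2 - B1) \<le> f\<close> by (auto simp: u_def intro!: image_eqI[of _ _ k])
    qed (use B1 in auto)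
  qed
  have "W \<subseteq> span (K \<union> u ` {..<f})" using B2(4) span_mono[OF sub] by auto
  moreover have "span (K \<union> u ` {..<f}) \<subseteq> W"
    using K uW by (intro span_minimal W(1)) auto
  ultimately show ?thesis using uW by (intro exI[of _ u]) auto
qed

section \<open>Spanning trees of the neighbor graph\<close>

text \<open>The rank is the length of a shortest path to \<open>q\<close>; the first arc of such a
  path lowers it.\<close>

lemma rtrancl_rank:
  "\<exists>\<rho> :: 'a \<Rightarrow> nat. \<forall>x. (x, q) \<in> r\<^sup>* \<longrightarrow> x \<noteq> q \<longrightarrow> (\<exists>y. (x, y) \<in> r \<and> (y, q) \<in> r\<^sup>* \<and> \<rho> y < \<rho> x)"
proof -
  define \<rho> where "\<rho> x = (LEAST k. (x, q) \<in> r ^^ k)" for x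
  have "\<exists>y. (x, y) \<in> r \<and> (y, q) \<in> r\<^sup>* \<and> \<rho> y < \<rho> x" if x: "(x, q) \<in> r\<^sup>*" "x \<noteq> q" for x
  proof -
    have "\<exists>k. (x, q) \<in> r ^^ k" using x(1) by (simp add: rtrancl_is_UN_relpow)
    then have "(x, q) \<in> r ^^ \<rho> x" unfolding \<rho>_def by (rule LeastI_ex)
    moreover then obtain k where k: "\<rho> x = Suc k" using x(2) by (cases "\<rho> x") auto
    ultimately obtain y where y: "(x, y) \<in> r" "(y, q) \<in> r ^^ k" using relpow_Suc_D2[of x q k r] by auto
    then have "\<rho> y \<le> k" unfolding \<rho>_def by (intro Least_le)
    then show ?thesis using y k by (intro exI[of _ y]) (auto simp: relpow_imp_rtrancl)
  qed
  then show ?thesis by blast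
qed

text \<open>Shortest paths to \<open>q\<close> use only arcs that lower the distance. Keeping just
  these arcs makes the graph acyclic without losing reachability of \<open>q\<close>.\<close>

lemma strongly_connected_in_tree:
  assumes sc: "strongly_connected m Nb" and q: "q < m"
  shows "\<exists>\<rho> :: nat \<Rightarrow> nat. \<forall>j<m. (j, q) \<in> {(j, i) \<in> nb_arcs m Nb. \<rho> i < \<rho> j}\<^sup>*"
proof -
  obtain \<rho> :: "nat \<Rightarrow> nat" where
    \<rho>: "\<forall>x. (x, q) \<in> (nb_arcs m Nb)\<^sup>* \<longrightarrow> x \<noteq> q \<longrightarrow>
      (\<exists>y. (x, y) \<in> nb_arcs m Nb \<and> (y, q) \<in> (nb_arcs m Nb)\<^sup>* \<and> \<rho> y < \<rho> x)"
    using rtrancl_rank[of q "nb_arcs m Nb"] by (rule exE)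
  have "(j, q) \<in> {(j, i) \<in> nb_arcs m Nb. \<rho> i < \<rho> j}\<^sup>*" if "(j, q) \<in> (nb_arcs m Nb)\<^sup>*" for j
    using that
  proof (induction "\<rho> j" arbitrary: j rule: less_induct)
    case less
    show ?case
    proof (cases "j = q")
      case False
      then obtain y where y: "(j, y) \<in> nb_arcs m Nb" "(y, q) \<in> (nb_arcs m Nb)\<^sup>*" "\<rho> y < \<rho> j"
        using \<rho> less.prems by blast
      then show ?thesis using less.hyps[of y] by (auto intro: converse_rtrancl_into_rtrancl)
    qed auto
  qed
  then show ?thesis using sc q by (intro exI[of _ \<rho>]) (simp add: strongly_connected_def)
qed

text \<open>The distance argument applied to the reversed graph; \<open>par\<close> selects one
  in-neighbor that is closer to the root.\<close>

lemma strongly_connected_out_tree: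
  assumes sc: "strongly_connected m Nb" and q: "q < m"
  shows "\<exists>\<delta> par :: nat \<Rightarrow> nat. \<forall>i. i < m \<and> i \<noteq> q \<longrightarrow> (par i, i) \<in> nb_arcs m Nb \<and> (\<delta> (par i) :: nat) < \<delta> i"
proof -
  obtain \<delta> :: "nat \<Rightarrow> nat" where
    \<delta>: "\<forall>x. (x, q) \<in> ((nb_arcs m Nb)\<inverse>)\<^sup>* \<longrightarrow> x \<noteq> q \<longrightarrow>
      (\<exists>y. (x, y) \<in> (nb_arcs m Nb)\<inverse> \<and> (y, q) \<in> ((nb_arcs m Nb)\<inverse>)\<^sup>* \<and> \<delta> y < \<delta> x)"
    using rtrancl_rank[of q "(nb_arcs m Nb)\<inverse>"] by (rule exE)
  have "\<exists>y. (y, i) \<in> nb_arcs m Nb \<and> \<delta> y < \<delta> i" if "i < m" "i \<noteq> q" for i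
  proof -
    have "(i, q) \<in> ((nb_arcs m Nb)\<inverse>)\<^sup>*"
      using sc q that by (simp add: rtrancl_converse strongly_connected_def)
    from \<delta>[rule_format, OF this that(2)] show ?thesis by auto
  qed
  then have "\<forall>i. \<exists>y. i < m \<and> i \<noteq> q \<longrightarrow> (y, i) \<in> nb_arcs m Nb \<and> \<delta> y < \<delta> i" by blast
  then show ?thesis by (intro exI[of _ \<delta>] choice)
qed

section \<open>Linear differential equations\<close>

lemma pow_mat_Suc_left:
  assumes "H \<in> carrier_mat N N"
  shows "H ^\<^sub>m Suc k = H * H ^\<^sub>m k"
proof (induction k)
  case (Suc k)
  have "H ^\<^sub>m Suc (Suc k) = (H * H ^\<^sub>m k) * H" using Suc by simp
  also have "\<dots> = H * (H ^\<^sub>m k * H)" using assms by (intro assoc_mult_mat) (auto intro: pow_carrier_mat)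
  finally show ?case by simp
qed (use assms in simp)

text \<open>Geometric growth of the entries lets the scalar exponential series dominate the one in
  \<open>mat_exp\<close>.\<close>

lemma pow_mat_entry_bound:
  fixes H :: "real mat"
  assumes H: "H \<in> carrier_mat N N" and b: "b = 1 + (\<Sum>i<N. \<Sum>j<N. \<bar>H $$ (i, j)\<bar>)"
    and "r < N" "c < N"
  shows "\<bar>(H ^\<^sub>m k) $$ (r, c)\<bar> \<le> b ^ k"
  using \<open>c < N\<close>
proof (induction k arbitrary: c)
  case 0
  then show ?case using assms by auto
next
  case (Suc k)
  have Hk: "H ^\<^sub>m k \<in> carrier_mat N N" using H by (rule pow_carrier_mat)
  have "(\<Sum>j<N. \<bar>H $$ (j, c)\<bar>) \<le> (\<Sum>i<N. \<Sum>j<N. \<bar>H $$ (i, j)\<bar>)"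
    by (intro sum_mono member_le_sum) (use Suc.prems in auto)
  then have colsum: "(\<Sum>j<N. \<bar>H $$ (j, c)\<bar>) \<le> b" using b by simp
  have "b \<ge> 0" using b by (simp add: sum_nonneg add_nonneg_nonneg)
  have "(H ^\<^sub>m Suc k) $$ (r, c) = (\<Sum>j<N. (H ^\<^sub>m k) $$ (r, j) * H $$ (j, c))"
    using H Hk \<open>r < N\<close> Suc.prems by (simp add: scalar_prod_def atLeast0LessThan)
  also have "\<bar>\<dots>\<bar> \<le> (\<Sum>j<N. \<bar>(H ^\<^sub>m k) $$ (r, j)\<bar> * \<bar>H $$ (j, c)\<bar>)"
    by (rule order_trans[OF sum_abs]) (simp add: abs_mult)
  also have "\<dots> \<le> (\<Sum>j<N. b ^ k * \<bar>H $$ (j, c)\<bar>)"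
    by (intro sum_mono mult_right_mono Suc.IH) auto
  also have "\<dots> \<le> b ^ k * b"
    unfolding sum_distrib_left[symmetric] using colsum \<open>b \<ge> 0\<close> by (intro mult_left_mono) auto
  finally show ?case by (simp add: mult.commute)
qed

lemma mat_exp_zero:
  assumes "H \<in> carrier_mat N N"
  shows "mat_exp 0 H = 1\<^sub>m N"
proof (rule eq_matI)
  fix r c assume rc: "r < dim_row (1\<^sub>m N :: real mat)" "c < dim_col (1\<^sub>m N :: real mat)"
  have "(\<Sum>k. (0 ^ k / fact k) * ((H ^\<^sub>m k) $$ (r, c))) = (\<Sum>k\<in>{0}. (0 ^ k / fact k) * ((H ^\<^sub>m k) $$ (r, c)))"
    by (rule suminf_finite) (auto simp: power_0_left)
  then show "mat_exp 0 H $$ (r, c) = 1\<^sub>m N $$ (r, c)"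
    using assms rc by (auto simp: mat_exp_def)
qed (use assms in \<open>auto simp: mat_exp_def\<close>)

text \<open>Each entry is an everywhere convergent power series and is differentiated termwise; the
  shifted coefficients are those of \<open>H\<close> times the series since
  \<open>H ^\<^sub>m Suc k = H * H ^\<^sub>m k\<close>.\<close>

lemma mat_exp_has_derivative:
  fixes H :: "real mat"
  assumes H: "H \<in> carrier_mat N N" and rc: "r < N" "c < N"
  shows "((\<lambda>t. mat_exp t H $$ (r, c)) has_real_derivative (\<Sum>j<N. H $$ (r, j) * mat_exp t H $$ (j, c))) (at t)"
proof -
  define b where "b = 1 + (\<Sum>i<N. \<Sum>j<N. \<bar>H $$ (i, j)\<bar>)"
  define co where "co i k = (H ^\<^sub>m k) $$ (i, c) / fact k" for i k
  have entry: "mat_exp t H $$ (i, c) = (\<Sum>k. co i k * t ^ k)" if "i < N" for i t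
    using H rc that by (simp add: mat_exp_def co_def mult.commute)
  have summ: "summable (\<lambda>k. co i k * y ^ k)" if "i < N" for i y
  proof (rule summable_comparison_test')
    show "summable (\<lambda>k. (b * \<bar>y\<bar>) ^ k / fact k)" using summable_exp[of "b * \<bar>y\<bar>"]
      by (simp add: divide_inverse mult.commute)
    fix k
    have "norm (co i k * y ^ k) = \<bar>(H ^\<^sub>m k) $$ (i, c)\<bar> * \<bar>y\<bar> ^ k / fact k"
      by (simp add: co_def abs_mult power_abs)
    also have "\<dots> \<le> b ^ k * \<bar>y\<bar> ^ k / fact k"
      by (intro divide_right_mono mult_right_mono pow_mat_entry_bound[OF H b_def that rc(2)]) auto
    finally show "norm (co i k * y ^ k) \<le> (b * \<bar>y\<bar>) ^ k / fact k" by (simp add: power_mult_distrib)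
  qed
  have diff: "diffs (co r) k = (\<Sum>j<N. H $$ (r, j) * co j k)" for k
  proof -
    have Hk: "H ^\<^sub>m k \<in> carrier_mat N N" using H by (rule pow_carrier_mat)
    have "(H ^\<^sub>m Suc k) $$ (r, c) = (\<Sum>j<N. H $$ (r, j) * (H ^\<^sub>m k) $$ (j, c))"
      unfolding pow_mat_Suc_left[OF H] using H Hk rc by (simp add: scalar_prod_def atLeast0LessThan)
    then have "diffs (co r) k = (\<Sum>j<N. H $$ (r, j) * (H ^\<^sub>m k) $$ (j, c)) / fact k"
      by (simp add: diffs_def co_def fact_Suc del: pow_mat.simps of_nat_Suc)
    then show ?thesis by (simp add: co_def sum_divide_distrib)
  qed
  have "((\<lambda>t. \<Sum>k. co r k * t ^ k) has_real_derivative (\<Sum>k. diffs (co r) k * t ^ k)) (at t)"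
    by (rule termdiffs_strong_converges_everywhere) (rule summ[OF rc(1)])
  also have "(\<Sum>k. diffs (co r) k * t ^ k) = (\<Sum>k. \<Sum>j<N. H $$ (r, j) * (co j k * t ^ k))"
    by (simp add: diff sum_distrib_right mult.assoc)
  also have "\<dots> = (\<Sum>j<N. \<Sum>k. H $$ (r, j) * (co j k * t ^ k))"
    by (rule suminf_sum) (auto intro: summable_mult summ)
  also have "\<dots> = (\<Sum>j<N. H $$ (r, j) * mat_exp t H $$ (j, c))"
    by (intro sum.cong refl) (simp add: entry suminf_mult[OF summ])
  finally show ?thesis by (simp add: entry[OF rc(1)])
qed

text \<open>Gronwall argument: the sum of squares \<open>V\<close> satisfies
  \<open>V' \<le> 2 * b * V\<close>, so \<open>V\<close> damped by the matching exponential cannot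
  grow from its initial value 0.\<close>

lemma linear_ode_zero:
  fixes H :: "nat \<Rightarrow> nat \<Rightarrow> real" and d :: "nat \<Rightarrow> real \<Rightarrow> real"
  assumes deriv: "\<And>p t. p < N \<Longrightarrow> t \<ge> 0 \<Longrightarrow>
      (d p has_real_derivative (\<Sum>c<N. H p c * d c t)) (at t within {0..})"
    and init: "\<And>p. p < N \<Longrightarrow> d p 0 = 0" and "p < N" "t \<ge> 0"
  shows "d p t = 0"
proof -
  \<comment> \<open>Each product of two components is bounded by \<open>V\<close>, so the sum of all
    absolute coefficients is a sufficient growth rate.\<close>
  define b where "b = (\<Sum>p<N. \<Sum>c<N. \<bar>H p c\<bar>)"
  define V where "V t = (\<Sum>p<N. (d p t)\<^sup>2)" for t
  define V' where "V' t = (\<Sum>p<N. 2 * d p t * (\<Sum>c<N. H p c * d c t))" for t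
  define g where "g t = exp (- 2 * b * t) * V t" for t
  have dV: "(V has_real_derivative V' t) (at t within {0..})" if "t \<ge> 0" for t
    unfolding V_def[abs_def] V'_def
    by (rule DERIV_sum) (use deriv that in \<open>auto intro!: derivative_eq_intros\<close>)
  have dg: "(g has_real_derivative (exp (- 2 * b * t) * (V' t - 2 * b * V t))) (at t within {0..})"
    if "t \<ge> 0" for t
    unfolding g_def[abs_def] by (auto intro!: derivative_eq_intros dV that simp: algebra_simps)
  have V'b: "V' t \<le> 2 * b * V t" for t
  proof -
    have prod: "\<bar>d p t * d c t\<bar> \<le> V t" if "p < N" "c < N" for p c
    proof -
      have "(d p t)\<^sup>2 \<le> V t" "(d c t)\<^sup>2 \<le> V t"
        unfolding V_def using that by (auto intro: member_le_sum)
      moreover have "2 * \<bar>d p t * d c t\<bar> \<le> (d p t)\<^sup>2 + (d c t)\<^sup>2"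
        using sum_squares_bound[of "\<bar>d p t\<bar>" "\<bar>d c t\<bar>"] by (simp add: abs_mult)
      ultimately show ?thesis by linarith
    qed
    have "V' t = (\<Sum>p<N. \<Sum>c<N. 2 * (H p c * (d p t * d c t)))"
      by (simp add: V'_def sum_distrib_left algebra_simps)
    also have "\<dots> \<le> (\<Sum>p<N. \<Sum>c<N. 2 * (\<bar>H p c\<bar> * V t))"
    proof (intro sum_mono)
      fix p c assume "p \<in> {..<N}" "c \<in> {..<N}"
      then have "\<bar>H p c\<bar> * \<bar>d p t * d c t\<bar> \<le> \<bar>H p c\<bar> * V t"
        by (intro mult_left_mono prod) auto
      moreover have "H p c * (d p t * d c t) \<le> \<bar>H p c\<bar> * \<bar>d p t * d c t\<bar>"
        by (metis abs_ge_self abs_mult)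
      ultimately show "2 * (H p c * (d p t * d c t)) \<le> 2 * (\<bar>H p c\<bar> * V t)" by linarith
    qed
    also have "\<dots> = 2 * b * V t"
      by (simp add: b_def sum_distrib_left sum_distrib_right mult.assoc)
    finally show ?thesis .
  qed
  have "g t \<le> g 0"
  proof (rule DERIV_nonpos_imp_decreasing_open[OF \<open>t \<ge> 0\<close>])
    fix x assume x: "0 < x" "x < t"
    \<comment> \<open>The derivative is only one-sided at 0; it is two-sided in the interior, where
      the monotonicity criterion asks for it.\<close>
    then have "at x within {0..} = at x" by (intro at_within_interior) auto
    then have "(g has_real_derivative (exp (- 2 * b * x) * (V' x - 2 * b * V x))) (at x)"
      using dg[of x] x by simp
    moreover have "exp (- 2 * b * x) * (V' x - 2 * b * V x) \<le> 0"
      by (rule mult_nonneg_nonpos) (use V'b[of x] in auto)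
    ultimately show "\<exists>y. (g has_real_derivative y) (at x) \<and> y \<le> 0" by blast
  next
    show "continuous_on {0..t} g"
      by (rule continuous_on_subset[of "{0..}"]) (auto intro: DERIV_continuous_on dg)
  qed
  moreover have "g 0 = 0" by (simp add: g_def V_def init)
  ultimately have "V t \<le> 0" by (simp add: g_def mult_le_0_iff)
  moreover have "(d p t)\<^sup>2 \<le> V t"
    unfolding V_def using \<open>p < N\<close> by (auto intro: member_le_sum)
  ultimately have "(d p t)\<^sup>2 \<le> 0" by linarith
  then show ?thesis by simp
qed

text \<open>Uniqueness: the difference from the exponential solution solves the same equation with
  initial value 0.\<close>

lemma linear_ode_mat_exp:
  fixes d :: "nat \<Rightarrow> real \<Rightarrow> real"
  assumes H: "H \<in> carrier_mat N N"
    and deriv: "\<And>p t. p < N \<Longrightarrow> t \<ge> 0 \<Longrightarrow>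
      (d p has_real_derivative (\<Sum>c<N. H $$ (p, c) * d c t)) (at t within {0..})"
    and "p < N" "t \<ge> 0"
  shows "d p t = (\<Sum>c<N. mat_exp t H $$ (p, c) * d c 0)"
proof -
  let ?E = "\<lambda>p t. \<Sum>c<N. mat_exp t H $$ (p, c) * d c 0"
  have "d p t - ?E p t = 0"
  proof (rule linear_ode_zero[where d = "\<lambda>p t. d p t - ?E p t" and H = "\<lambda>p c. H $$ (p, c)" and N = N])
    fix p t assume p: "p < N" "(t::real) \<ge> 0"
    have "(?E p has_real_derivative (\<Sum>c<N. (\<Sum>j<N. H $$ (p, j) * mat_exp t H $$ (j, c)) * d c 0)) (at t within {0..})"
      by (intro DERIV_sum DERIV_cmult_right has_field_derivative_at_within[OF mat_exp_has_derivative[OF H]])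
         (use p in auto)
    moreover have "(\<Sum>c<N. (\<Sum>j<N. H $$ (p, j) * mat_exp t H $$ (j, c)) * d c 0) = (\<Sum>j<N. H $$ (p, j) * ?E j t)"
      unfolding sum_distrib_left sum_distrib_right by (subst sum.swap) (simp add: mult.assoc)
    ultimately show "((\<lambda>t. d p t - ?E p t) has_real_derivative (\<Sum>c<N. H $$ (p, c) * (d c t - ?E c t))) (at t within {0..})"
      using DERIV_diff[OF deriv[OF p]] by (simp add: right_diff_distrib sum_subtractf)
  next
    fix p assume p: "p < N"
    have "?E p 0 = (\<Sum>c<N. if p = c then d c 0 else 0)"
      using p by (intro sum.cong) (auto simp: mat_exp_zero[OF H])
    then show "d p 0 - ?E p 0 = 0" using p by simp
  qed (use assms in auto)
  then show ?thesis by simp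
qed

section \<open>Norm estimates against the matrix exponential\<close>

lemma mnorm_nonneg: "mnorm M \<ge> 0"
  by (simp add: mnorm_def sum_nonneg)

lemma abs_entry_le_mnorm:
  assumes "r < dim_row M" "c < dim_col M"
  shows "\<bar>M $$ (r, c)\<bar> \<le> mnorm M"
proof -
  have "(M $$ (r, c))\<^sup>2 \<le> (\<Sum>c<dim_col M. (M $$ (r, c))\<^sup>2)"
    using assms by (intro member_le_sum) auto
  also have "\<dots> \<le> (\<Sum>r<dim_row M. \<Sum>c<dim_col M. (M $$ (r, c))\<^sup>2)"
    using assms by (intro member_le_sum[where f = "\<lambda>r. \<Sum>c<dim_col M. (M $$ (r, c))\<^sup>2"]) (auto intro: sum_nonneg)
  finally show ?thesis unfolding mnorm_def by (metis real_sqrt_abs real_sqrt_le_mono)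
qed

lemma vnorm_le_sum_abs: "vnorm v \<le> (\<Sum>k<dim_vec v. \<bar>v $ k\<bar>)"
  unfolding vnorm_def using L2_set_le_sum_abs[of "\<lambda>k. v $ k" "{..<dim_vec v}"]
  by (simp add: L2_set_def)

text \<open>In the application \<open>G\<close> holds reconstruction weights and \<open>w\<close>
  the initial errors, so the factor in front of \<open>mnorm\<close> does not involve time.\<close>

lemma vnorm_mat_exp_bound:
  fixes G :: "nat \<Rightarrow> nat \<Rightarrow> real"
  assumes H: "H \<in> carrier_mat N N" and v: "v \<in> carrier_vec n"
    and eq: "\<And>k. k < n \<Longrightarrow> v $ k = (\<Sum>p<N. G k p * (\<Sum>c<N. mat_exp t H $$ (p, c) * w c))"
  shows "vnorm v \<le> (\<Sum>k<n. \<Sum>p<N. \<Sum>c<N. \<bar>G k p\<bar> * \<bar>w c\<bar>) * mnorm (mat_exp t H)"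
proof -
  have "\<bar>v $ k\<bar> \<le> (\<Sum>p<N. \<Sum>c<N. \<bar>G k p\<bar> * \<bar>w c\<bar> * mnorm (mat_exp t H))" if "k < n" for k
  proof -
    have "v $ k = (\<Sum>p<N. \<Sum>c<N. G k p * (mat_exp t H $$ (p, c) * w c))"
      using eq that by (simp add: sum_distrib_left)
    also have "\<bar>\<dots>\<bar> \<le> (\<Sum>p<N. \<Sum>c<N. \<bar>G k p * (mat_exp t H $$ (p, c) * w c)\<bar>)"
      by (intro order_trans[OF sum_abs] sum_mono) auto
    also have "\<dots> \<le> (\<Sum>p<N. \<Sum>c<N. \<bar>G k p\<bar> * \<bar>w c\<bar> * mnorm (mat_exp t H))"
    proof (intro sum_mono)
      fix p c assume "p \<in> {..<N}" "c \<in> {..<N}"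
      then have "\<bar>mat_exp t H $$ (p, c)\<bar> \<le> mnorm (mat_exp t H)"
        using H by (intro abs_entry_le_mnorm) (auto simp: mat_exp_def)
      then have "\<bar>G k p\<bar> * \<bar>w c\<bar> * \<bar>mat_exp t H $$ (p, c)\<bar> \<le> \<bar>G k p\<bar> * \<bar>w c\<bar> * mnorm (mat_exp t H)"
        by (intro mult_left_mono) auto
      then show "\<bar>G k p * (mat_exp t H $$ (p, c) * w c)\<bar> \<le> \<bar>G k p\<bar> * \<bar>w c\<bar> * mnorm (mat_exp t H)"
        by (simp add: abs_mult algebra_simps)
    qed
    finally show ?thesis .
  qed
  then have "(\<Sum>k<n. \<bar>v $ k\<bar>) \<le> (\<Sum>k<n. \<Sum>p<N. \<Sum>c<N. \<bar>G k p\<bar> * \<bar>w c\<bar> * mnorm (mat_exp t H))"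
    by (intro sum_mono) auto
  moreover have "vnorm v \<le> (\<Sum>k<n. \<bar>v $ k\<bar>)"
    using vnorm_le_sum_abs[of v] carrier_vecD[OF v] by simp
  ultimately show ?thesis by (simp only: sum_distrib_right)
qed

section \<open>Spectra of block matrices\<close>

lemma offs_Suc [simp]: "offs d (Suc i) = offs d i + d i"
  by (simp add: offs_def)

lemma offs_0 [simp]: "offs d 0 = 0"
  by (simp add: offs_def)

lemma offs_mono: "i \<le> j \<Longrightarrow> offs d i \<le> offs d j"
  unfolding offs_def by (intro sum_mono2) auto

lemma blk_offs_add:
  assumes "k < d i"
  shows "blk d (offs d i + k) = i"
  unfolding blk_def
proof (rule Least_equality)
  fix j assume "offs d i + k < offs d (Suc j)"
  then have "\<not> Suc j \<le> i" using offs_mono[of "Suc j" i d] by linarith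
  then show "i \<le> j" by simp
qed (use assms in simp)

lemma offs_decompose:
  assumes "r < offs d m"
  obtains i k where "i < m" "k < d i" "r = offs d i + k"
proof -
  have "\<exists>i<m. \<exists>k<d i. r = offs d i + k"
    using assms
  proof (induction m)
    case (Suc m)
    show ?case
    proof (cases "r < offs d m")
      case True
      then show ?thesis using Suc.IH less_SucI by blast
    next
      case False
      then show ?thesis using Suc.prems by (intro exI[of _ m]) (auto intro!: exI[of _ "r - offs d m"])
    qed
  qed auto
  then show ?thesis using that by blast
qed

text \<open>Lets sums and determinants pass between flat indices and pairs (block, local index).
  Empty blocks are allowed.\<close>

lemma bij_betw_offs:
  "bij_betw (\<lambda>(i, k). offs d i + k) (Sigma {..<m} (\<lambda>i. {..<d i})) {..<offs d m}"
  unfolding bij_betw_def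
proof
  show "inj_on (\<lambda>(i, k). offs d i + k) (Sigma {..<m} (\<lambda>i. {..<d i}))"
    by (rule inj_on_inverseI[where g = "\<lambda>r. (blk d r, r - offs d (blk d r))"]) (auto simp: blk_offs_add)
  have "\<exists>i<m. \<exists>k<d i. r = offs d i + k" if "r < offs d m" for r
    using offs_decompose[OF that] by metis
  moreover have "offs d i + k < offs d m" if "i < m" "k < d i" for i k
    using that offs_mono[of "Suc i" m d] by simp
  ultimately show "(\<lambda>(i, k). offs d i + k) ` Sigma {..<m} (\<lambda>i. {..<d i}) = {..<offs d m}"
    by (fastforce simp: image_iff)
qed

lemma block_mat_carrier: "block_mat rd cd p q B \<in> carrier_mat (offs rd p) (offs cd q)"
  by (simp add: block_mat_def)

lemma block_mat_entry:
  assumes "i < p" "k < rd i" "j < q" "l < cd j"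
  shows "block_mat rd cd p q B $$ (offs rd i + k, offs cd j + l) = B i j $$ (k, l)"
proof -
  have "offs rd i + k < offs rd p" "offs cd j + l < offs cd q"
    using assms bij_betwE[OF bij_betw_offs[of rd p]] bij_betwE[OF bij_betw_offs[of cd q]] by auto
  then show ?thesis using assms by (simp add: block_mat_def blk_offs_add)
qed

lemma index_mat_mult_vec:
  assumes "k < p" "dim_vec v = q"
  shows "(mat p q f *\<^sub>v v) $ k = (\<Sum>l<q. f (k, l) * v $ l)"
  using assms by (simp add: scalar_prod_def atLeast0LessThan)

text \<open>With pair indices the cells can be ordered by level inside \<open>fdet\<close>, without
  permuting the matrix itself.\<close>

lemma char_poly_block_mat:
  fixes B :: "nat \<Rightarrow> nat \<Rightarrow> real mat"
  assumes "\<And>i k j l. i < m \<Longrightarrow> k < d i \<Longrightarrow> j < m \<Longrightarrow> l < d j \<Longrightarrow> B i j $$ (k, l) = h i k j l"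
  shows "char_poly (map_mat complex_of_real (block_mat d d m m B))
    = fdet (Sigma {..<m} (\<lambda>i. {..<d i}))
        (\<lambda>(i, k) (j, l). (if (i, k) = (j, l) then [:0, 1:] else 0) - [:complex_of_real (h i k j l):])"
proof -
  let ?A = "map_mat complex_of_real (block_mat d d m m B)"
  let ?S = "Sigma {..<m} (\<lambda>i. {..<d i})" and ?\<phi> = "\<lambda>(i, k). offs d i + k"
  have A: "?A \<in> carrier_mat (offs d m) (offs d m)"
    using block_mat_carrier[of d d m m B] by simp
  have inj: "inj_on ?\<phi> ?S" and im: "?\<phi> ` ?S = {..<offs d m}"
    using bij_betw_offs[of d m] by (auto simp: bij_betw_def)
  have lt: "?\<phi> x < offs d m" if "x \<in> ?S" for x using im that by blast
  have "char_poly ?A = fdet {..<offs d m} (\<lambda>r c. char_poly_matrix ?A $$ (r, c))"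
    unfolding char_poly_def by (rule det_eq_fdet) (use A in simp)
  also have "\<dots> = fdet ?S (\<lambda>x y. char_poly_matrix ?A $$ (?\<phi> x, ?\<phi> y))"
    unfolding im[symmetric] by (rule fdet_reindex[OF inj]) auto
  also have "\<dots> = fdet ?S (\<lambda>(i, k) (j, l). (if (i, k) = (j, l) then [:0, 1:] else 0) - [:complex_of_real (h i k j l):])"
  proof (rule fdet_cong)
    fix x y assume xy: "x \<in> ?S" "y \<in> ?S"
    obtain i k j l where ij: "x = (i, k)" "y = (j, l)" by (cases x, cases y)
    have eq: "(?\<phi> x = ?\<phi> y) = (x = y)" using inj_on_eq_iff[OF inj xy] .
    have "block_mat d d m m B $$ (?\<phi> x, ?\<phi> y) = h i k j l"
      using xy assms by (simp add: ij block_mat_entry)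
    then have "char_poly_matrix ?A $$ (?\<phi> x, ?\<phi> y)
        = (if x = y then [:0, 1:] else 0) - [:complex_of_real (h i k j l):]"
      using lt[OF xy(1)] lt[OF xy(2)] eq block_mat_carrier[of d d m m B]
      by (simp add: char_poly_matrix_def)
    then show "char_poly_matrix ?A $$ (?\<phi> x, ?\<phi> y) = (case x of (i, k) \<Rightarrow> \<lambda>(j, l).
        (if (i, k) = (j, l) then [:0, 1:] else 0) - [:complex_of_real (h i k j l):]) y"
      by (simp add: ij)
  qed
  finally show ?thesis .
qed

text \<open>Agent i carries a first cell (local indices below e i) and a second cell (f i further
  indices); the Boolean tells the two apart.\<close>
lemma fdet_cells:
  fixes h x :: "nat \<Rightarrow> nat \<Rightarrow> nat \<Rightarrow> nat \<Rightarrow> real" and level :: "nat \<times> bool \<Rightarrow> nat"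
    and m :: nat and e f :: "nat \<Rightarrow> nat" and \<beta> :: "nat \<times> bool \<Rightarrow> nat \<Rightarrow> real"
  defines "S \<equiv> Sigma {..<m} (\<lambda>i. {..<e i + f i})"
    and "sz \<equiv> \<lambda>(i, b). if b then f i else e i"
  assumes h: "\<And>i k j l. h i k j l = x i k j l
      + (if j = i \<and> (k < e i \<longleftrightarrow> l < e i)
         then (if k < e i then companion (\<beta> (i, False)) k l else companion (\<beta> (i, True)) (k - e i) (l - e i))
         else 0)"
    and x: "\<And>i k j l. (i, k) \<in> S \<Longrightarrow> (j, l) \<in> S \<Longrightarrow> x i k j l \<noteq> 0 \<Longrightarrow> level (j, l \<ge> e j) < level (i, k \<ge> e i)"
    and inj: "inj_on level ({..<m} \<times> UNIV)"
  shows "fdet S (\<lambda>(i, k) (j, l). (if (i, k) = (j, l) then [:0, 1:] else 0) - [:complex_of_real (h i k j l):])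
    = (\<Prod>b\<in>{..<m} \<times> UNIV. fdet {..<sz b}
        (\<lambda>k l. (if k = l then [:0, 1:] else 0) - [:complex_of_real (companion (\<beta> b) k l):]))"
proof -
  let ?B = "{..<m} \<times> (UNIV :: bool set)"
  let ?M = "\<lambda>(i, k) (j, l). (if (i, k) = (j, l) then [:0, 1:] else 0) - [:complex_of_real (h i k j l):]"
  let ?N = "\<lambda>b k l. (if k = l then [:0, 1:] else 0) - [:complex_of_real (companion (\<beta> b) k l):]"
  let ?lev = "\<lambda>(i, k). level (i, k \<ge> e i)"
  have finS: "finite S" unfolding S_def by auto
  have "fdet S ?M = (\<Prod>v\<in>level ` ?B. fdet {y\<in>S. ?lev y = v} ?M)"
  proof (rule fdet_levels[OF finS])
    show "?lev ` S \<subseteq> level ` ?B" by (auto simp: S_def)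
    fix y z assume yz: "y \<in> S" "z \<in> S" "?lev y < ?lev z"
    obtain i k j l where ij: "y = (i, k)" "z = (j, l)" by (cases y, cases z)
    have "x i k j l = 0" using x[of i k j l] yz ij by force
    moreover have "\<not> (j = i \<and> (k < e i \<longleftrightarrow> l < e i))" 
      using yz by (cases "k < e i"; cases "l < e i") (auto simp: ij not_less)
    ultimately have "h i k j l = 0" by (auto simp: h)
    moreover have "y \<noteq> z" using yz(3) by auto
    ultimately show "?M y z = 0" by (auto simp: ij)
  qed auto
  \<comment> \<open>As \<open>level\<close> is injective, each level carries a single cell, and the
    product over levels becomes one over cells.\<close>
  also have "\<dots> = (\<Prod>b\<in>?B. fdet {y\<in>S. ?lev y = level b} ?M)"
    by (rule prod.reindex[OF inj, unfolded o_def])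
  also have "\<dots> = (\<Prod>b\<in>?B. fdet {..<sz b} (?N b))"
  proof (rule prod.cong[OF refl])
    fix b assume b: "b \<in> ?B"
    obtain i t where it: "b = (i, t)" by (cases b)
    have i: "i < m" using b it by auto
    \<comment> \<open>Start of the cell among the local indices of agent \<open>i\<close>.\<close>
    define st where "st = (if t then e i else 0)"
    have cell: "{y\<in>S. ?lev y = level b} = (\<lambda>k. (i, st + k)) ` {..<sz b}"
    proof (intro equalityI subsetI)
      fix y assume y: "y \<in> {y\<in>S. ?lev y = level b}"
      obtain j l where jl: "y = (j, l)" by (cases y)
      have "(j, l \<ge> e j) = b" using y jl b inj by (auto simp: S_def dest: inj_onD)
      then have "j = i" "t = (l \<ge> e i)" using it by auto
      then show "y \<in> (\<lambda>k. (i, st + k)) ` {..<sz b}"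
        using y by (intro image_eqI[of _ _ "l - st"]) (auto simp: jl S_def st_def sz_def it split: if_splits)
    next
      fix y assume "y \<in> (\<lambda>k. (i, st + k)) ` {..<sz b}"
      then show "y \<in> {y\<in>S. ?lev y = level b}"
        using i by (auto simp: S_def sz_def st_def it split: if_splits)
    qed
    have "fdet {y\<in>S. ?lev y = level b} ?M = fdet {..<sz b} (\<lambda>k l. ?M (i, st + k) (i, st + l))"
      unfolding cell by (rule fdet_reindex) (auto simp: inj_on_def)
    also have "\<dots> = fdet {..<sz b} (?N b)"
    proof (rule fdet_cong)
      fix k l assume kl: "k \<in> {..<sz b}" "l \<in> {..<sz b}"
      have S: "(i, st + k) \<in> S" "(i, st + l) \<in> S" and lev: "(st + k \<ge> e i) = t" "(st + l \<ge> e i) = t"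
        using kl i by (auto simp: S_def sz_def st_def it split: if_splits)
      \<comment> \<open>Inside a cell the coupling vanishes, since it would require the level to be
        smaller than itself.\<close>
      have "x i (st + k) i (st + l) = 0" using x[OF S] lev by auto
      then have "h i (st + k) i (st + l) = companion (\<beta> b) k l"
        using lev by (auto simp: h it st_def split: if_splits)
      then show "?M (i, st + k) (i, st + l) = ?N b k l" by simp
    qed
    finally show "fdet {y\<in>S. ?lev y = level b} ?M = fdet {..<sz b} (?N b)" .
  qed
  finally show ?thesis .
qed

lemma prod_mset_sum_mset:
  "(\<Prod>b\<in>B. \<Prod>a\<in>#F b. g a) = (\<Prod>a\<in>#(\<Sum>b\<in>B. F b). g a)"
  by (induction B rule: infinite_finite_induct) auto

section \<open>Gathering and relaying\<close>

lemma funpow_closed: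
  assumes "x \<in> U" "a ` U \<subseteq> U"
  shows "(a ^^ p) x \<in> U"
  using assms by (induction p) auto

text \<open>Here a is the action g \<mapsto> gA on row functionals, c j r is row r of the j-th output matrix,
  and K i collects what agent i learns in the gathering phase along the decreasing rank.\<close>
locale gathering =
  fixes a :: "'v::real_vector \<Rightarrow> 'v" and c :: "nat \<Rightarrow> nat \<Rightarrow> 'v" and s :: "nat \<Rightarrow> nat"
    and m :: nat and Nb :: "nat \<Rightarrow> nat set" and \<rho> :: "nat \<Rightarrow> nat"
  assumes lin: "linear a"
begin

text \<open>Arcs along which information is gathered; the strictly falling rank excludes
  cycles.\<close>

definition E :: "(nat \<times> nat) set" where
  "E = {(j, i) \<in> nb_arcs m Nb. \<rho> i < \<rho> j}"

text \<open>Explicit generators from all agents upstream of \<open>i\<close>, which avoids a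
  recursion along the rank.\<close>

definition gens :: "nat \<Rightarrow> 'v set" where
  "gens i = {(a ^^ p) (c j r) | p j r. (j, i) \<in> E\<^sup>* \<and> r < s j}"

definition K :: "nat \<Rightarrow> 'v set" where
  "K i = span (gens i)"

text \<open>What counts as measured for agent \<open>i\<close>: its own outputs together with
  everything its predecessors estimate. By the lemmas below, \<open>K i\<close> is the smallest
  \<open>a\<close>-invariant space above it.\<close>

definition Q :: "nat \<Rightarrow> 'v set" where
  "Q i = span (c i ` {..<s i} \<union> (\<Union>j\<in>{j. (j, i) \<in> E}. K j))"

lemma K_invariant: "a ` K i \<subseteq> K i"
proof -
  have "a ` gens i \<subseteq> gens i"
  proof
    fix y assume "y \<in> a ` gens i"
    then obtain p j r where "y = (a ^^ Suc p) (c j r)" "(j, i) \<in> E\<^sup>*" "r < s j"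
      unfolding gens_def by auto
    then show "y \<in> gens i" unfolding gens_def by blast
  qed
  then show ?thesis unfolding K_def linear_span_image[OF lin, symmetric] by (rule span_mono)
qed

lemma output_in_K: "r < s i \<Longrightarrow> c i r \<in> K i"
proof -
  assume "r < s i"
  then have "(a ^^ 0) (c i r) \<in> gens i" unfolding gens_def by blast
  then show ?thesis unfolding K_def by (simp add: span_base)
qed

lemma K_mono: "(j, i) \<in> E \<Longrightarrow> K j \<subseteq> K i"
proof -
  assume ji: "(j, i) \<in> E"
  have "gens j \<subseteq> gens i"
  proof
    fix y assume "y \<in> gens j"
    then obtain p j' r where "y = (a ^^ p) (c j' r)" "(j', j) \<in> E\<^sup>*" "r < s j'"
      unfolding gens_def by auto
    moreover then have "(j', i) \<in> E\<^sup>*" using ji by (rule_tac rtrancl_into_rtrancl)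
    ultimately show "y \<in> gens i" unfolding gens_def by blast
  qed
  then show ?thesis unfolding K_def by (rule span_mono)
qed

lemma Q_subset_K: "Q i \<subseteq> K i"
proof -
  have "c i ` {..<s i} \<union> (\<Union>j\<in>{j. (j, i) \<in> E}. K j) \<subseteq> K i"
    by (intro Un_least UN_least) (auto intro: output_in_K subsetD[OF K_mono])
  then show ?thesis unfolding Q_def by (intro span_minimal) (auto simp: K_def)
qed

text \<open>A generator originates either at \<open>i\<close>, where invariance of \<open>U\<close>
  handles the powers of \<open>a\<close>, or upstream, where the last arc on its way places it in
  the space of a predecessor, hence in \<open>Q i\<close>.\<close>

lemma K_minimal:
  assumes U: "subspace U" "Q i \<subseteq> U" "a ` U \<subseteq> U"
  shows "K i \<subseteq> U"
proof -
  have sub: "c i ` {..<s i} \<union> (\<Union>j\<in>{j. (j, i) \<in> E}. K j) \<subseteq> U"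
    using U(2) unfolding Q_def by (rule order_trans[OF span_superset])
  have "gens i \<subseteq> U"
  proof
    fix y assume "y \<in> gens i"
    then obtain p j r where y: "y = (a ^^ p) (c j r)" "(j, i) \<in> E\<^sup>*" "r < s j"
      unfolding gens_def by auto
    show "y \<in> U"
    proof (cases "j = i")
      case True
      then have "c j r \<in> U" using y sub by auto
      then show ?thesis using U(3) y(1) by (simp add: funpow_closed)
    next
      case False
      then obtain j' where "(j, j') \<in> E\<^sup>*" "(j', i) \<in> E" using y(2) by (meson rtranclE)
      then have "y \<in> gens j'" using y by (auto simp: gens_def)
      then have "y \<in> K j'" unfolding K_def by (rule span_base)
      then show ?thesis using sub \<open>(j', i) \<in> E\<close> by auto
    qed
  qed
  then show ?thesis unfolding K_def by (rule span_minimal) (rule U(1))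
qed

end

text \<open>Converts a combination of admissible signals \<open>I\<close>, with \<open>Inl\<close>
  for states and \<open>Inr\<close> for outputs, into the double sums of the observer equations;
  inadmissible signals get coefficient 0.\<close>

lemma sum_Plus_Sigma_scaleR:
  fixes g :: "nat \<times> nat + nat \<times> nat \<Rightarrow> 'v::real_vector"
  assumes fin: "finite J" and I: "I \<subseteq> Sigma J (\<lambda>j. {..<u j}) <+> Sigma J (\<lambda>j. {..<v j})"
  shows "(\<Sum>x\<in>I. \<eta> x *\<^sub>R g x)
    = (\<Sum>j\<in>J. \<Sum>l<u j. (if Inl (j, l) \<in> I then \<eta> (Inl (j, l)) else 0) *\<^sub>R g (Inl (j, l)))
    + (\<Sum>j\<in>J. \<Sum>r<v j. (if Inr (j, r) \<in> I then \<eta> (Inr (j, r)) else 0) *\<^sub>R g (Inr (j, r)))"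
proof -
  let ?F = "Sigma J (\<lambda>j. {..<u j}) <+> Sigma J (\<lambda>j. {..<v j})"
  let ?t = "\<lambda>x. (if x \<in> I then \<eta> x else 0) *\<^sub>R g x"
  have "(\<Sum>x\<in>I. \<eta> x *\<^sub>R g x) = (\<Sum>x\<in>?F. ?t x)"
    using fin I by (intro sum.mono_neutral_cong_left) auto
  also have "\<dots> = (\<Sum>x\<in>Sigma J (\<lambda>j. {..<u j}). ?t (Inl x)) + (\<Sum>x\<in>Sigma J (\<lambda>j. {..<v j}). ?t (Inr x))"
    using fin by (subst sum.Plus) (auto simp: o_def)
  also have "(\<Sum>x\<in>Sigma J (\<lambda>j. {..<u j}). ?t (Inl x)) = (\<Sum>j\<in>J. \<Sum>l<u j. ?t (Inl (j, l)))"
    using fin by (subst sum.Sigma) (auto intro!: sum.cong)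
  also have "(\<Sum>x\<in>Sigma J (\<lambda>j. {..<v j}). ?t (Inr x)) = (\<Sum>j\<in>J. \<Sum>r<v j. ?t (Inr (j, r)))"
    using fin by (subst sum.Sigma) (auto intro!: sum.cong)
  finally show ?thesis .
qed

lemma sum_two_cells:
  fixes T :: "nat \<Rightarrow> 'v::real_vector"
  shows "(\<Sum>l<e + f. (if k < e \<longleftrightarrow> l < e then (if k < e then A k l else B (k - e) (l - e)) else 0) *\<^sub>R T l)
    = (if k < e then (\<Sum>l<e. A k l *\<^sub>R T l) else (\<Sum>l<f. B (k - e) l *\<^sub>R T (e + l)))"
proof -
  let ?g = "\<lambda>l. (if k < e \<longleftrightarrow> l < e then (if k < e then A k l else B (k - e) (l - e)) else 0) *\<^sub>R T l"
  have "sum ?g {..<e + f} = sum ?g {..<e} + sum ?g {e..<e + f}"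
    using sum.atLeastLessThan_concat[of 0 e "e + f" ?g] by (simp only: atLeast0LessThan)
  also have "sum ?g {e..<e + f} = (\<Sum>l<f. ?g (e + l))"
    by (simp only: sum.atLeastLessThan_shift_0 add_diff_cancel_left' o_def atLeast0LessThan)
  finally show ?thesis by auto
qed

text \<open>The algebraic core. The conclusions give, in order, the total size, the sparsity imposed
  by the graph, the autonomous error equation, reconstruction by each agent alone, and the
  spectrum.\<close>

lemma distributed_observer_functionals:
  fixes a :: "'v::real_vector \<Rightarrow> 'v" and c :: "nat \<Rightarrow> nat \<Rightarrow> 'v" and s :: "nat \<Rightarrow> nat"
    and \<Lambda> :: "complex multiset"
  assumes lin: "linear a" and B: "finite B" "card B \<le> n"
    and W: "span {(a ^^ p) (c j r) | p j r. j < m \<and> r < s j} = span B"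
    and nz: "\<And>i. i < m \<Longrightarrow> \<exists>r<s i. c i r \<noteq> 0"
    and m: "m \<ge> 1"
    and Nb: "\<And>i. i < m \<Longrightarrow> Nb i \<subseteq> {..<m}" "\<And>i. i < m \<Longrightarrow> i \<in> Nb i" "strongly_connected m Nb"
    and size: "size \<Lambda> = m * n + m - 1" and sym: "image_mset cnj \<Lambda> = \<Lambda>"
  obtains ns :: "nat \<Rightarrow> nat" and h \<kappa> :: "nat \<Rightarrow> nat \<Rightarrow> nat \<Rightarrow> nat \<Rightarrow> real" and T :: "nat \<Rightarrow> nat \<Rightarrow> 'v"
  where "(\<Sum>i<m. ns i) = m * n + m - 1"
    "\<And>i k j l. i < m \<Longrightarrow> k < ns i \<Longrightarrow> j \<notin> Nb i \<Longrightarrow> h i k j l = 0"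
    "\<And>i k. i < m \<Longrightarrow> k < ns i \<Longrightarrow> a (T i k)
      = (\<Sum>j\<in>Nb i. \<Sum>l<ns j. h i k j l *\<^sub>R T j l) + (\<Sum>j\<in>Nb i. \<Sum>r<s j. \<kappa> i k j r *\<^sub>R c j r)"
    "\<And>i. i < m \<Longrightarrow> span B \<subseteq> span (T i ` {..<ns i} \<union> c i ` {..<s i})"
    "fdet (Sigma {..<m} (\<lambda>i. {..<ns i}))
      (\<lambda>(i, k) (j, l). (if (i, k) = (j, l) then [:0, 1:] else 0) - [:complex_of_real (h i k j l):])
      = (\<Prod>a\<in>#\<Lambda>. [:- a, 1:])"
proof -
  define q :: nat where "q = 0"
  have q: "q < m" using m by (simp add: q_def)
  obtain \<rho> :: "nat \<Rightarrow> nat" where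
    "\<forall>j<m. (j, q) \<in> {(j, i) \<in> nb_arcs m Nb. \<rho> i < \<rho> j}\<^sup>*"
    using strongly_connected_in_tree[OF Nb(3) q] by (rule exE)
  note \<rho> = this[rule_format]
  obtain \<delta> par :: "nat \<Rightarrow> nat" where
    "\<forall>i. i < m \<and> i \<noteq> q \<longrightarrow> (par i, i) \<in> nb_arcs m Nb \<and> \<delta> (par i) < \<delta> i"
    using strongly_connected_out_tree[OF Nb(3) q] by (elim exE)
  note par = this[rule_format, OF conjI]
  interpret gathering a c s m Nb \<rho> by (rule gathering.intro) (rule lin)
  let ?W = "span B"
  have arcE: "j < m \<and> j \<in> Nb i \<and> \<rho> i < \<rho> j" if "(j, i) \<in> E" for i j
    using that by (auto simp: E_def nb_arcs_def)
  have reachE: "j < m" if "(j, i) \<in> E\<^sup>*" "i < m" for i j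
    using that by (induction rule: converse_rtrancl_induct) (auto dest: arcE)
  have KW: "K i \<subseteq> ?W" if "i < m" for i
    unfolding K_def gens_def W[symmetric] using that reachE by (intro span_mono) blast
  \<comment> \<open>Every agent reaches \<open>q\<close> along \<open>E\<close>, so all generators
    of \<open>?W\<close> occur in \<open>gens q\<close>.\<close>
  have Kq: "K q = ?W"
  proof
    show "?W \<subseteq> K q"
      unfolding K_def gens_def W[symmetric] using \<rho> by (intro span_mono) (auto simp: E_def)
  qed (rule KW[OF q])
  have subK: "subspace (K i)" for i by (simp add: K_def)
  have dimK: "dim (K i) \<le> n" if "i < m" for i
    using dim_le_card[OF KW[OF that] B(1)] B(2) by simp
  have dimW: "dim ?W \<le> n" using dim_le_card[of ?W B] B by simp

  \<comment> \<open>\<open>e\<close> rounds the dimension down to an even number, \<open>f0\<close>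
    rounds the missing part up, and the root's second cell absorbs the remaining dimensions, of
    whatever parity.\<close>
  define e where "e i = 2 * (dim (K i) div 2)" for i
  define f0 where "f0 i = 2 * ((n - e i + 1) div 2)" for i
  define f where "f i = (if i = q then m * n + m - 1 - e q - (\<Sum>i\<in>{..<m} - {q}. e i + f0 i) else f0 i)" for i
  define ns where "ns i = e i + f i" for i
  have e_le: "e i \<le> dim (K i)" for i by (simp add: e_def)
  have ef0: "e i + f0 i \<le> n + 1" if "i < m" for i
    using order_trans[OF e_le dimK[OF that]] by (simp add: f0_def)
  \<comment> \<open>Shows that the natural-number subtraction defining \<open>f q\<close> does not
    truncate: the root needs at most n, each other agent at most n + 1.\<close>
  have sum_le: "e q + (\<Sum>i\<in>{..<m} - {q}. e i + f0 i) \<le> m * n + m - 1"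
  proof -
    have "(\<Sum>i\<in>{..<m} - {q}. e i + f0 i) \<le> (\<Sum>i\<in>{..<m} - {q}. n + 1)"
      by (intro sum_mono ef0) auto
    also have "\<dots> = (m - 1) * (n + 1)" using q by simp
    finally have "e q + (\<Sum>i\<in>{..<m} - {q}. e i + f0 i) \<le> n + (m - 1) * (n + 1)"
      using order_trans[OF e_le dimK[OF q]] by simp
    also have "\<dots> = m * n + m - 1" using m by (cases m) auto
    finally show ?thesis .
  qed
  have sum_ns: "(\<Sum>i<m. ns i) = m * n + m - 1"
  proof -
    have "(\<Sum>i<m. ns i) = ns q + (\<Sum>i\<in>{..<m} - {q}. e i + f0 i)"
      using q by (subst sum.remove[of _ q]) (auto simp: ns_def f_def)
    then show ?thesis using sum_le by (simp add: ns_def f_def)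
  qed

  let ?C = "{..<m} \<times> (UNIV :: bool set)"
  define sz where "sz = (\<lambda>(i, b). if b then f i else e i)"
  have "sum sz ?C = size \<Lambda>"
  proof -
    have "sum sz ?C = (\<Sum>i<m. \<Sum>b\<in>UNIV. sz (i, b))" by (simp add: sum.cartesian_product)
    also have "\<dots> = (\<Sum>i<m. ns i)" by (simp add: UNIV_bool sz_def ns_def add.commute)
    finally show ?thesis using sum_ns size by simp
  qed
  \<comment> \<open>The root's second cell is the only one that may be odd, hence it plays the part
    of \<open>b0\<close> in the splitting of \<open>\<Lambda>\<close>.\<close>
  moreover have "even (sz b)" if "b \<in> ?C" "b \<noteq> (q, True)" for b
    using that by (cases b) (auto simp: sz_def e_def f_def f0_def)
  ultimately have "\<exists>F. (\<forall>b\<in>?C. image_mset cnj (F b) = F b \<and> size (F b) = sz b) \<and> (\<Sum>b\<in>?C. F b) = \<Lambda>"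
    using q by (intro symmetric_mset_partition[OF sym, where ?b0.0 = "(q, True)"]) auto
  then obtain F where "(\<forall>b\<in>?C. image_mset cnj (F b) = F b \<and> size (F b) = sz b) \<and> (\<Sum>b\<in>?C. F b) = \<Lambda>"
    by (rule exE)
  then have F: "\<forall>b\<in>?C. image_mset cnj (F b) = F b" "\<forall>b\<in>?C. size (F b) = sz b" "(\<Sum>b\<in>?C. F b) = \<Lambda>"
    by auto
  have "\<forall>b\<in>?C. \<exists>\<beta>. fdet {..<sz b} (\<lambda>k l. (if k = l then [:0, 1:] else 0) - [:complex_of_real (companion \<beta> k l):])
      = (\<Prod>a\<in>#F b. [:- a, 1:])"
  proof
    fix b assume b: "b \<in> ?C"
    from symmetric_roots_companion[OF F(1)[rule_format, OF b]]
    show "\<exists>\<beta>. fdet {..<sz b} (\<lambda>k l. (if k = l then [:0, 1:] else 0) - [:complex_of_real (companion \<beta> k l):])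
      = (\<Prod>a\<in>#F b. [:- a, 1:])" unfolding F(2)[rule_format, OF b] .
  qed
  from bchoice[OF this] obtain \<beta> where \<beta>: "\<forall>b\<in>?C.
      fdet {..<sz b} (\<lambda>k l. (if k = l then [:0, 1:] else 0) - [:complex_of_real (companion (\<beta> b) k l):])
      = (\<Prod>a\<in>#F b. [:- a, 1:])"
    by (rule exE)

  have "\<exists>r0 u. r0 < s i \<and> (\<forall>k<e i. a (u k) - (\<Sum>l<e i. companion (\<beta> (i, False)) k l *\<^sub>R u l) \<in> Q i)
      \<and> span (insert (c i r0) (u ` {..<e i})) = K i" if i: "i < m" for i
  proof -
    obtain r0 where r0: "r0 < s i" "c i r0 \<noteq> 0" using nz[OF i] by blast
    have cQ: "c i r0 \<in> Q i" unfolding Q_def using r0 by (intro span_base) auto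
    have subQ: "subspace (Q i)" by (simp add: Q_def)
    have min: "\<forall>U. subspace U \<and> Q i \<subseteq> U \<and> a ` U \<subseteq> U \<longrightarrow> K i \<subseteq> U" using K_minimal by blast
    show ?thesis
      using even_observer_cell[OF lin subQ Q_subset_K subK K_invariant B(1) KW[OF i] min cQ r0(2) e_def[of i],
        of "\<beta> (i, False)"] r0(1)
      by blast
  qed
  then have "\<forall>i. \<exists>r0 u. i < m \<longrightarrow> r0 < s i
      \<and> (\<forall>k<e i. a (u k) - (\<Sum>l<e i. companion (\<beta> (i, False)) k l *\<^sub>R u l) \<in> Q i)
      \<and> span (insert (c i r0) (u ` {..<e i})) = K i" by blast
  then obtain r0 where "\<forall>i. \<exists>u. i < m \<longrightarrow> r0 i < s i
      \<and> (\<forall>k<e i. a (u k) - (\<Sum>l<e i. companion (\<beta> (i, False)) k l *\<^sub>R u l) \<in> Q i)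
      \<and> span (insert (c i (r0 i)) (u ` {..<e i})) = K i"
    by (rule choice[THEN exE])
  then obtain u1 where "\<forall>i. i < m \<longrightarrow> r0 i < s i
      \<and> (\<forall>k<e i. a (u1 i k) - (\<Sum>l<e i. companion (\<beta> (i, False)) k l *\<^sub>R u1 i l) \<in> Q i)
      \<and> span (insert (c i (r0 i)) (u1 i ` {..<e i})) = K i"
    by (rule choice[THEN exE])
  then have r0: "\<And>i. i < m \<Longrightarrow> r0 i < s i"
    and u1: "\<And>i k. i < m \<Longrightarrow> k < e i \<Longrightarrow>
        a (u1 i k) - (\<Sum>l<e i. companion (\<beta> (i, False)) k l *\<^sub>R u1 i l) \<in> Q i"
    and spanK: "\<And>i. i < m \<Longrightarrow> span (insert (c i (r0 i)) (u1 i ` {..<e i})) = K i"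
    by auto
  \<comment> \<open>At the root nothing is missing, as \<open>K q = ?W\<close>. Its second cell
    estimates the zero functional and thus can run autonomously with any dynamics.\<close>
  define compl where "compl i u \<longleftrightarrow> (\<forall>k. u k \<in> ?W) \<and> span (K i \<union> u ` {..<f i}) = ?W
    \<and> (i = q \<longrightarrow> (\<forall>k. u k = 0))" for i u
  have "\<exists>u. compl i u" if i: "i < m" for i
  proof (cases "i = q")
    case True
    have "span (?W \<union> (\<lambda>_. 0) ` {..<f q}) = ?W"
      by (intro span_unique) (auto simp: span_zero span_minimal)
    then show ?thesis using True Kq by (intro exI[of _ "\<lambda>_. 0"]) (auto simp: span_zero compl_def)
  next
    case False
    have "n \<le> e i + f i" using False by (simp add: f_def f0_def)
    then have "dim ?W \<le> dim (K i) + f i" using dimW e_le[of i] by linarith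
    then show ?thesis
      using complete_functionals[OF subK KW[OF i] subspace_span order_refl B(1)] False by (simp add: compl_def)
  qed
  then have "\<forall>i. \<exists>u. i < m \<longrightarrow> compl i u" by blast
  then obtain u2 where "\<forall>i. i < m \<longrightarrow> compl i (u2 i)"
    by (rule choice[THEN exE])
  then have u2: "\<And>i k. i < m \<Longrightarrow> u2 i k \<in> ?W"
    "\<And>i. i < m \<Longrightarrow> span (K i \<union> u2 i ` {..<f i}) = ?W" "\<And>k. u2 q k = 0"
    unfolding compl_def
    using q by auto

  define T where "T i k = (if k < e i then u1 i k else u2 i (k - e i))" for i k
  have T_im: "u1 i ` {..<e i} \<subseteq> T i ` {..<ns i}" "u2 i ` {..<f i} \<subseteq> T i ` {..<ns i}" for i
  proof -
    show "u1 i ` {..<e i} \<subseteq> T i ` {..<ns i}" by (auto simp: T_def ns_def)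
    have "u2 i k = T i (e i + k)" for k by (simp add: T_def)
    then show "u2 i ` {..<f i} \<subseteq> T i ` {..<ns i}" by (auto simp: ns_def)
  qed
  have full: "?W \<subseteq> span (T i ` {..<ns i} \<union> c i ` {..<s i})" if i: "i < m" for i
  proof -
    let ?S = "span (T i ` {..<ns i} \<union> c i ` {..<s i})"
    have "K i \<subseteq> ?S"
      using T_im(1)[of i] r0[OF i] by (subst spanK[OF i, symmetric], intro span_mono) auto
    moreover have "u2 i ` {..<f i} \<subseteq> ?S"
      using T_im(2)[of i] by (intro order_trans[OF _ span_superset]) auto
    ultimately have "span (K i \<union> u2 i ` {..<f i}) \<subseteq> ?S" by (intro span_minimal) auto
    then show ?thesis by (simp only: u2(2)[OF i])
  qed
  have TW: "T i k \<in> ?W" if "i < m" "k < ns i" for i k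
  proof (cases "k < e i")
    case True
    have "u1 i k \<in> span (insert (c i (r0 i)) (u1 i ` {..<e i}))" using True by (intro span_base) auto
    then show ?thesis using True KW[OF that(1)] by (auto simp: spanK that(1) T_def)
  qed (use u2 that in \<open>auto simp: T_def\<close>)

  \<comment> \<open>Received signals as functionals: \<open>Inl\<close> for observer states,
    \<open>Inr\<close> for output rows.\<close>
  define sig where "sig = case_sum (\<lambda>(j, l). T j l) (\<lambda>(j, r). c j r)"
  \<comment> \<open>Signals that may drive row \<open>k\<close> besides its own cell. Gathering rows
    use first cells of predecessors in \<open>E\<close> and outputs of all neighbors; relaying rows
    use everything held by the parent; the root's second cell uses nothing.\<close>
  define I where "I i k = (if k < e i
      then Inl ` Sigma {j. (j, i) \<in> E} (\<lambda>j. {..<e j}) \<union> Inr ` Sigma (Nb i) (\<lambda>j. {..<s j})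
      else if i = q then {}
      else Inl ` Sigma {par i} (\<lambda>j. {..<ns j}) \<union> Inr ` Sigma {par i} (\<lambda>j. {..<s j}))" for i k
  have I_sub: "I i k \<subseteq> Sigma (Nb i) (\<lambda>j. {..<ns j}) <+> Sigma (Nb i) (\<lambda>j. {..<s j})" if i: "i < m" for i k
    using arcE par[OF i] by (auto simp: I_def Plus_def ns_def nb_arcs_def)
  have finNb: "finite (Nb i)" if "i < m" for i using Nb(1)[OF that] finite_subset by blast
  have finI: "finite (I i k)" if "i < m" for i k
    by (rule finite_subset[OF I_sub[OF that]]) (use finNb[OF that] in auto)
  define cell where "cell i k j l = (if j = i \<and> (k < e i \<longleftrightarrow> l < e i)
      then (if k < e i then companion (\<beta> (i, False)) k l else companion (\<beta> (i, True)) (k - e i) (l - e i))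
      else 0)" for i k j l
  have cell_sum: "(\<Sum>j\<in>Nb i. \<Sum>l<ns j. cell i k j l *\<^sub>R T j l)
      = (if k < e i then (\<Sum>l<e i. companion (\<beta> (i, False)) k l *\<^sub>R u1 i l)
         else (\<Sum>l<f i. companion (\<beta> (i, True)) (k - e i) l *\<^sub>R u2 i l))" if i: "i < m" for i k
  proof -
    have "(\<Sum>j\<in>Nb i. \<Sum>l<ns j. cell i k j l *\<^sub>R T j l) = (\<Sum>l<ns i. cell i k i l *\<^sub>R T i l)"
      using finNb[OF i] Nb(2)[OF i] by (subst sum.remove[of _ i]) (auto simp: cell_def)
    also have "\<dots> = (if k < e i then (\<Sum>l<e i. companion (\<beta> (i, False)) k l *\<^sub>R T i l)
         else (\<Sum>l<f i. companion (\<beta> (i, True)) (k - e i) l *\<^sub>R T i (e i + l)))"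
      unfolding sum_two_cells[symmetric] by (intro sum.cong) (auto simp: cell_def ns_def)
    also have "\<dots> = (if k < e i then (\<Sum>l<e i. companion (\<beta> (i, False)) k l *\<^sub>R u1 i l)
         else (\<Sum>l<f i. companion (\<beta> (i, True)) (k - e i) l *\<^sub>R u2 i l))"
      by (auto simp: T_def intro: sum.cong)
    finally show ?thesis .
  qed
  \<comment> \<open>Invariance of \<open>?W\<close> is inherited from \<open>K q\<close>.\<close>
  have aW: "a w \<in> ?W" if "w \<in> ?W" for w using K_invariant[of q] that by (auto simp: Kq)
  have resid: "a (T i k) - (\<Sum>j\<in>Nb i. \<Sum>l<ns j. cell i k j l *\<^sub>R T j l) \<in> span (sig ` I i k)"
    if i: "i < m" and k: "k < ns i" for i k
  proof -
    consider (first) "k < e i" | (root) "\<not> k < e i" "i = q" | (relay) "\<not> k < e i" "i \<noteq> q" by blast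
    then show ?thesis
    proof cases
      case first
      have "Q i \<subseteq> span (sig ` I i k)"
        unfolding Q_def
      proof (rule span_minimal[OF _ subspace_span], rule Un_least)
        have out: "c j r \<in> span (sig ` I i k)" if "j \<in> Nb i" "r < s j" for j r
          using first that by (intro span_base image_eqI[of _ _ "Inr (j, r)"]) (auto simp: sig_def I_def)
        show "c i ` {..<s i} \<subseteq> span (sig ` I i k)" using out Nb(2)[OF i] by auto
        show "(\<Union>j\<in>{j. (j, i) \<in> E}. K j) \<subseteq> span (sig ` I i k)"
        proof (rule UN_least)
          fix j assume "j \<in> {j. (j, i) \<in> E}"
          then have j: "(j, i) \<in> E" "j < m" "j \<in> Nb i" using arcE by auto
          have "u1 j l \<in> span (sig ` I i k)" if "l < e j" for l
            using first that j
            by (intro span_base image_eqI[of _ _ "Inl (j, l)"]) (auto simp: sig_def I_def T_def)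
          \<comment> \<open>If a reduced-order cell of \<open>j\<close> omits the row
            \<open>c j (r0 j)\<close>, agent \<open>i\<close> still receives it as an output, so all
            of \<open>K j\<close> is available.\<close>
          then show "K j \<subseteq> span (sig ` I i k)"
            using out[OF j(3) r0[OF j(2)]] by (subst spanK[OF j(2), symmetric], intro span_minimal) auto
        qed
      qed
      then show ?thesis using u1[OF i first] first unfolding cell_sum[OF i] by (auto simp: T_def)
    next
      case root
      then show ?thesis unfolding cell_sum[OF i] by (simp add: T_def u2(3) linear_0[OF lin] span_zero)
    next
      case relay
      have p: "par i < m" using par[OF i relay(2)] by (auto simp: nb_arcs_def)
      have "sig ` I i k = T (par i) ` {..<ns (par i)} \<union> c (par i) ` {..<s (par i)}"
        using relay by (force simp: I_def sig_def)
      moreover have "a (T i k) - (\<Sum>j\<in>Nb i. \<Sum>l<ns j. cell i k j l *\<^sub>R T j l) \<in> ?W"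
        unfolding cell_sum[OF i]
        using TW[OF i k] relay u2(1)[OF i] by (simp add: span_diff aW span_sum span_scale)
      \<comment> \<open>The parent's states and outputs span \<open>?W\<close>, so any companion
        block is admissible for a relaying cell.\<close>
      ultimately show ?thesis using full[OF p] by auto
    qed
  qed
  have "\<forall>i k. \<exists>\<eta>. i < m \<and> k < ns i \<longrightarrow>
      a (T i k) - (\<Sum>j\<in>Nb i. \<Sum>l<ns j. cell i k j l *\<^sub>R T j l) = (\<Sum>x\<in>I i k. \<eta> x *\<^sub>R sig x)"
    using span_image_sum[OF finI resid] by blast
  then obtain \<eta> where \<eta>: "\<forall>i k. i < m \<and> k < ns i \<longrightarrow>
      a (T i k) - (\<Sum>j\<in>Nb i. \<Sum>l<ns j. cell i k j l *\<^sub>R T j l) = (\<Sum>x\<in>I i k. \<eta> i k x *\<^sub>R sig x)"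
    by (subst (asm) choice_iff, subst (asm) choice_iff) (rule exE)
  define x where "x i k j l = (if Inl (j, l) \<in> I i k then \<eta> i k (Inl (j, l)) else 0)" for i k j l
  define \<kappa> where "\<kappa> i k j r = (if Inr (j, r) \<in> I i k then \<eta> i k (Inr (j, r)) else 0)" for i k j r
  define h where "h i k j l = x i k j l + cell i k j l" for i k j l
  have dyn: "a (T i k) = (\<Sum>j\<in>Nb i. \<Sum>l<ns j. h i k j l *\<^sub>R T j l) + (\<Sum>j\<in>Nb i. \<Sum>r<s j. \<kappa> i k j r *\<^sub>R c j r)"
    if i: "i < m" and k: "k < ns i" for i k
  proof -
    have "a (T i k) = (\<Sum>j\<in>Nb i. \<Sum>l<ns j. cell i k j l *\<^sub>R T j l) + (\<Sum>x\<in>I i k. \<eta> i k x *\<^sub>R sig x)"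
      using \<eta>[rule_format, OF conjI[OF i k]] by (simp add: algebra_simps)
    also have "(\<Sum>x\<in>I i k. \<eta> i k x *\<^sub>R sig x)
        = (\<Sum>j\<in>Nb i. \<Sum>l<ns j. x i k j l *\<^sub>R T j l) + (\<Sum>j\<in>Nb i. \<Sum>r<s j. \<kappa> i k j r *\<^sub>R c j r)"
      by (subst sum_Plus_Sigma_scaleR[OF finNb[OF i] I_sub[OF i]]) (simp add: x_def \<kappa>_def sig_def)
    finally show ?thesis by (simp add: h_def scaleR_add_left sum.distrib)
  qed
  have sparse: "h i k j l = 0" if "i < m" "k < ns i" "j \<notin> Nb i" for i k j l
    using I_sub[OF that(1), of k] Nb(2)[OF that(1)] that(3) by (auto simp: h_def x_def cell_def)

  \<comment> \<open>An upper bound of all ranks, so that \<open>R - \<rho> i\<close> reverses their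
    order without truncation.\<close>
  define R where "R = (\<Sum>i<m. \<rho> i)"
  have R: "\<rho> i \<le> R" if "i < m" for i unfolding R_def using that by (intro member_le_sum) auto
  \<comment> \<open>All gathering cells precede all relaying cells; within a phase the distance
    orders them, and the last digit in base \<open>m\<close> separates agents.\<close>
  define level where "level = (\<lambda>(i, b). (if b then R + 1 + \<delta> i else R - \<rho> i) * m + i)"
  have inj_level: "inj_on level ?C"
  proof (rule inj_onI)
    fix y z assume yz: "y \<in> ?C" "z \<in> ?C" "level y = level z"
    obtain i b j b' where ib: "y = (i, b)" "z = (j, b')" by (cases y, cases z)
    have ij: "i < m" "j < m" and eq: "level (i, b) = level (j, b')" using yz ib by auto
    have "i = j" using arg_cong[OF eq, of "\<lambda>v. v mod m"] ij by (simp add: level_def)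
    moreover have "(if b then R + 1 + \<delta> i else R - \<rho> i) = (if b' then R + 1 + \<delta> j else R - \<rho> j)"
      using arg_cong[OF eq, of "\<lambda>v. v div m"] ij by (simp add: level_def)
    moreover have "R - \<rho> i < R + 1 + \<delta> i" for i by simp
    ultimately show "y = z" by (cases b; cases b') (auto simp: ib)
  qed
  have level_less: "A * m + j < A' * m + i" if "A < A'" "j < m" for A A' i j :: nat
  proof -
    have "A * m + j < Suc A * m" using that by simp
    also have "\<dots> \<le> A' * m" using that by (intro mult_le_mono1) simp
    finally show ?thesis by simp
  qed
  have tri: "level (j, l \<ge> e j) < level (i, k \<ge> e i)"
    if i: "i < m" "k < ns i" and j: "j < m" and nz: "x i k j l \<noteq> 0" for i k j l
  proof -
    have mem: "Inl (j, l) \<in> I i k" using nz by (auto simp: x_def split: if_splits)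
    show ?thesis
    proof (cases "k < e i")
      case True
      then have "(j, i) \<in> E" "l < e j" using mem by (auto simp: I_def)
      then have "\<rho> i < \<rho> j" "\<not> l \<ge> e j" "\<not> k \<ge> e i" using arcE True by auto
      then show ?thesis using R[OF j] j by (auto simp: level_def intro!: level_less)
    next
      case False
      then have "i \<noteq> q" "j = par i" using mem by (auto simp: I_def split: if_splits)
      then have "\<delta> j < \<delta> i" using par[OF i(1)] by auto
      \<comment> \<open>A signal from the parent comes either from its gathering cell, which is of
        the earlier phase, or from its relaying cell, which is closer to the root.\<close>
      then have "(if l \<ge> e j then R + 1 + \<delta> j else R - \<rho> j) < R + 1 + \<delta> i" by auto
      from level_less[OF this j, of i] show ?thesis using False by (simp add: level_def)
    qed
  qed
  have "fdet (Sigma {..<m} (\<lambda>i. {..<e i + f i}))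
      (\<lambda>(i, k) (j, l). (if (i, k) = (j, l) then [:0, 1:] else 0) - [:complex_of_real (h i k j l):])
    = (\<Prod>b\<in>?C. fdet {..<(\<lambda>(i, b). if b then f i else e i) b}
        (\<lambda>k l. (if k = l then [:0, 1:] else 0) - [:complex_of_real (companion (\<beta> b) k l):]))"
    by (rule fdet_cells[where x = x and level = level])
       (use tri inj_level in \<open>auto simp: h_def cell_def ns_def\<close>)
  also have "\<dots> = (\<Prod>b\<in>?C. \<Prod>a\<in>#F b. [:- a, 1:])"
    by (intro prod.cong refl) (use \<beta> in \<open>auto simp: sz_def\<close>)
  also have "\<dots> = (\<Prod>a\<in>#\<Lambda>. [:- a, 1:])" by (simp add: prod_mset_sum_mset F(3))
  finally have det: "fdet (Sigma {..<m} (\<lambda>i. {..<ns i}))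
      (\<lambda>(i, k) (j, l). (if (i, k) = (j, l) then [:0, 1:] else 0) - [:complex_of_real (h i k j l):])
    = (\<Prod>a\<in>#\<Lambda>. [:- a, 1:])" by (simp add: ns_def)
  show ?thesis by (rule that[OF sum_ns sparse dyn full det])
qed

section \<open>The observer\<close>

definition unit_fun :: "nat \<Rightarrow> nat \<Rightarrow> real" where
  "unit_fun i = (\<lambda>j. if j = i then 1 else 0)"

definition row_fun :: "nat \<Rightarrow> real mat \<Rightarrow> nat \<Rightarrow> nat \<Rightarrow> real" where
  "row_fun n C r = (\<lambda>i. if i < n then C $$ (r, i) else 0)"

text \<open>The row functional g A. The cut-off at \<open>n\<close> keeps it in the span of the
  first \<open>n\<close> unit functionals.\<close>

definition mult_fun :: "nat \<Rightarrow> real mat \<Rightarrow> (nat \<Rightarrow> real) \<Rightarrow> nat \<Rightarrow> real" where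
  "mult_fun n A g = (\<lambda>i. if i < n then \<Sum>l<n. g l * A $$ (l, i) else 0)"

definition pairing :: "nat \<Rightarrow> (nat \<Rightarrow> real) \<Rightarrow> real vec \<Rightarrow> real" where
  "pairing n g v = (\<Sum>i<n. g i * v $ i)"

lemma linear_mult_fun: "linear (mult_fun n A)"
  by (rule linearI) (auto simp: mult_fun_def fun_eq_iff sum.distrib algebra_simps sum_distrib_left)

section \<open>Duality between functionals and state vectors\<close>

lemma linear_pairing: "linear (\<lambda>g. pairing n g v)"
  by (rule linearI) (auto simp: pairing_def sum.distrib algebra_simps sum_distrib_left)

lemma pairing_unit_fun: "k < n \<Longrightarrow> pairing n (unit_fun k) v = v $ k"
proof -
  assume k: "k < n"
  have "pairing n (unit_fun k) v = (\<Sum>i<n. if i = k then v $ i else 0)"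
    unfolding pairing_def unit_fun_def by (intro sum.cong) auto
  then show ?thesis using k by simp
qed

lemma pairing_row_fun:
  assumes "C \<in> carrier_mat p n" "v \<in> carrier_vec n" "r < p"
  shows "pairing n (row_fun n C r) v = (C *\<^sub>v v) $ r"
  using assms by (auto simp: pairing_def row_fun_def scalar_prod_def atLeast0LessThan intro: sum.cong)

lemma pairing_mult_fun:
  assumes A: "A \<in> carrier_mat n n" and v: "v \<in> carrier_vec n"
  shows "pairing n (mult_fun n A g) v = pairing n g (A *\<^sub>v v)"
proof -
  have "pairing n (mult_fun n A g) v = (\<Sum>i<n. \<Sum>l<n. g l * A $$ (l, i) * v $ i)"
    by (simp add: pairing_def mult_fun_def sum_distrib_right)
  also have "\<dots> = (\<Sum>l<n. \<Sum>i<n. g l * (A $$ (l, i) * v $ i))"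
    by (subst sum.swap) (simp add: mult.assoc)
  also have "\<dots> = pairing n g (A *\<^sub>v v)"
    using A v by (auto simp: pairing_def scalar_prod_def atLeast0LessThan sum_distrib_left intro!: sum.cong)
  finally show ?thesis .
qed

lemma pairing_funpow_mult_fun:
  assumes A: "A \<in> carrier_mat n n" and v: "v \<in> carrier_vec n"
  shows "pairing n ((mult_fun n A ^^ p) g) v = pairing n g ((A ^\<^sub>m p) *\<^sub>v v)"
  using v
proof (induction p arbitrary: v)
  case (Suc p)
  have Ap: "A ^\<^sub>m p \<in> carrier_mat n n" using A by (rule pow_carrier_mat)
  have "pairing n ((mult_fun n A ^^ Suc p) g) v = pairing n ((mult_fun n A ^^ p) g) (A *\<^sub>v v)"
    using A Suc.prems by (simp add: pairing_mult_fun)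
  also have "\<dots> = pairing n g ((A ^\<^sub>m p) *\<^sub>v (A *\<^sub>v v))"
    using A Suc.prems by (intro Suc.IH) auto
  also have "(A ^\<^sub>m p) *\<^sub>v (A *\<^sub>v v) = (A ^\<^sub>m Suc p) *\<^sub>v v"
    using assoc_mult_mat_vec[OF Ap A Suc.prems] by simp
  finally show ?case .
qed (use A in simp)

lemma fun_eq_sum_unit_fun:
  assumes "\<And>i. i \<ge> n \<Longrightarrow> g i = 0"
  shows "g = (\<Sum>i<n. g i *\<^sub>R unit_fun i)"
proof
  fix j
  have app: "(\<Sum>i\<in>I. F i) j = (\<Sum>i\<in>I. F i j)" for I :: "nat set" and F :: "nat \<Rightarrow> nat \<Rightarrow> real"
    by (induction I rule: infinite_finite_induct) auto
  have "(\<Sum>i<n. g i *\<^sub>R unit_fun i) j = (\<Sum>i<n. if i = j then g i else 0)"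
    unfolding app by (intro sum.cong) (auto simp: unit_fun_def)
  then show "g j = (\<Sum>i<n. g i *\<^sub>R unit_fun i) j" using assms[of j] by auto
qed

text \<open>If a unit functional were missed, a linear form vanishing on all generators but not on
  it would exist. Such a form is evaluation at a vector, and this vector would be nonzero and
  unobservable.\<close>

lemma observable_span:
  assumes A: "A \<in> carrier_mat n n" and C: "\<And>i. i < m \<Longrightarrow> C i \<in> carrier_mat (s i) n"
    and obs: "observable (block_mat s (\<lambda>_. n) m 1 (\<lambda>i j. C i)) A"
  shows "span {(mult_fun n A ^^ p) (row_fun n (C j) r) | p j r. j < m \<and> r < s j} = span (unit_fun ` {..<n})"
    (is "span ?G = span ?B")
proof (intro antisym span_minimal subspace_span)
  have supp: "g \<in> span ?B" if "\<And>i. i \<ge> n \<Longrightarrow> g i = 0" for g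
  proof -
    have "(\<Sum>i<n. g i *\<^sub>R unit_fun i) \<in> span ?B"
      by (intro span_sum span_scale) (auto intro: span_base)
    then show ?thesis by (subst fun_eq_sum_unit_fun[OF that])
  qed
  have "(mult_fun n A ^^ p) (row_fun n (C j) r) i = 0" if "i \<ge> n" for p j r i
    using that by (cases p) (auto simp: row_fun_def mult_fun_def)
  then show "?G \<subseteq> span ?B" using supp by auto
  show "?B \<subseteq> span ?G"
  proof (rule ccontr)
    assume "\<not> ?B \<subseteq> span ?G"
    then obtain i where i: "i < n" "unit_fun i \<notin> span ?G" by auto
    obtain Bs where Bs: "Bs \<subseteq> ?G" "independent Bs" "?G \<subseteq> span Bs"
      using maximal_independent_subset[of ?G] by blast
    have notin: "unit_fun i \<notin> span Bs" using i(2) span_mono[OF Bs(1)] by auto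
    then have ind: "independent (insert (unit_fun i) Bs)" using Bs(2) by (rule independent_insertI)
    obtain \<phi> :: "(nat \<Rightarrow> real) \<Rightarrow> real" where \<phi>: "linear \<phi>"
      "\<forall>g\<in>insert (unit_fun i) Bs. \<phi> g = (if g = unit_fun i then 1 else 0)"
      using linear_independent_extend[OF ind, of "\<lambda>g. if g = unit_fun i then 1 else 0"] by blast
    have "unit_fun i \<notin> Bs" using notin span_base by blast
    then have "\<phi> g = 0" if "g \<in> Bs" for g using \<phi>(2) that by auto
    then have zero: "\<phi> g = 0" if "g \<in> ?G" for g
      using linear_eq_0_on_span[OF \<phi>(1), of Bs g] that Bs(3) by blast
    \<comment> \<open>The vector representing \<open>\<phi>\<close> on functionals supported below
      \<open>n\<close>, as \<open>\<phi>v\<close> states.\<close>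
    define v where "v = vec n (\<lambda>j. \<phi> (unit_fun j))"
    have v: "v \<in> carrier_vec n" by (simp add: v_def)
    have \<phi>v: "\<phi> g = pairing n g v" if "\<And>i. i \<ge> n \<Longrightarrow> g i = 0" for g
      by (subst fun_eq_sum_unit_fun[of n g, OF that])
         (simp_all add: linear_sum[OF \<phi>(1)] linear_scale[OF \<phi>(1)] pairing_def v_def)
    let ?C = "block_mat s (\<lambda>_. n) m 1 (\<lambda>i j. C i)"
    have Cc: "?C \<in> carrier_mat (offs s m) n"
      using block_mat_carrier[of s "\<lambda>_. n" m 1 "\<lambda>i j. C i"] by simp
    have "?C * (A ^\<^sub>m k) *\<^sub>v v = 0\<^sub>v (offs s m)" for k
    proof (rule eq_vecI)
      have Ak: "A ^\<^sub>m k \<in> carrier_mat n n" using A by (rule pow_carrier_mat)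
      then have Akv: "A ^\<^sub>m k *\<^sub>v v \<in> carrier_vec n" using v by simp
      fix p assume p: "p < dim_vec (0\<^sub>v (offs s m) :: real vec)"
      then obtain j r where jr: "j < m" "r < s j" "p = offs s j + r"
        by (auto elim: offs_decompose)
      have "(?C * (A ^\<^sub>m k) *\<^sub>v v) $ p = (?C *\<^sub>v (A ^\<^sub>m k *\<^sub>v v)) $ p"
        using Cc Ak v by simp
      also have "\<dots> = (\<Sum>c<n. ?C $$ (p, c) * (A ^\<^sub>m k *\<^sub>v v) $ c)"
      proof -
        have "(?C *\<^sub>v y) $ p = (\<Sum>c<n. ?C $$ (p, c) * y $ c)" if "y \<in> carrier_vec n" for y
          using Cc that p by (simp add: scalar_prod_def atLeast0LessThan)
        then show ?thesis using Akv .
      qed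
      also have "\<dots> = (\<Sum>c<n. C j $$ (r, c) * (A ^\<^sub>m k *\<^sub>v v) $ c)"
        using block_mat_entry[of j m r s 0 1 _ "\<lambda>_. n" "\<lambda>i j. C i"] jr
        by (intro sum.cong) auto
      also have "\<dots> = pairing n (row_fun n (C j) r) (A ^\<^sub>m k *\<^sub>v v)"
        by (simp add: pairing_def row_fun_def)
      also have "\<dots> = \<phi> ((mult_fun n A ^^ k) (row_fun n (C j) r))"
        unfolding pairing_funpow_mult_fun[OF A v, symmetric]
        by (rule \<phi>v[symmetric]) (cases k; auto simp: row_fun_def mult_fun_def)
      also have "\<dots> = 0" using jr by (intro zero) blast
      finally show "(?C * (A ^\<^sub>m k) *\<^sub>v v) $ p = 0\<^sub>v (offs s m) $ p" using p by simp
    qed (use Cc in simp)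
    then have "v = 0\<^sub>v n" using obs A v Cc unfolding observable_def by auto
    moreover have "v $ i = 1" using \<phi>(2) i(1) by (simp add: v_def)
    ultimately show False using i(1) by simp
  qed
qed

text \<open>The output terms cancel in the derivative of z - T x, leaving the linear equation with
  matrix H. They cancel again in the estimate minus the state, which is therefore a fixed
  combination of these errors.\<close>

lemma observer_error_bound:
  fixes h \<kappa> :: "nat \<Rightarrow> nat \<Rightarrow> nat \<Rightarrow> nat \<Rightarrow> real" and T :: "nat \<Rightarrow> nat \<Rightarrow> nat \<Rightarrow> real"
    and \<mu> \<nu> :: "nat \<Rightarrow> nat \<Rightarrow> nat \<Rightarrow> real"
  assumes A: "A \<in> carrier_mat n n" and C: "\<And>i. i < m \<Longrightarrow> C i \<in> carrier_mat (s i) n"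
    and Nb: "\<And>i. i < m \<Longrightarrow> Nb i \<subseteq> {..<m}" "\<And>i. i < m \<Longrightarrow> i \<in> Nb i"
    and sparse: "\<And>i k j l. i < m \<Longrightarrow> k < ns i \<Longrightarrow> j \<notin> Nb i \<Longrightarrow> h i k j l = 0"
    and dyn: "\<And>i k. i < m \<Longrightarrow> k < ns i \<Longrightarrow> mult_fun n A (T i k)
      = (\<Sum>j\<in>Nb i. \<Sum>l<ns j. h i k j l *\<^sub>R T j l) + (\<Sum>j\<in>Nb i. \<Sum>r<s j. \<kappa> i k j r *\<^sub>R row_fun n (C j) r)"
    and recon: "\<And>i k. i < m \<Longrightarrow> k < n \<Longrightarrow> unit_fun k
      = (\<Sum>l<ns i. \<mu> i k l *\<^sub>R T i l) + (\<Sum>r<s i. \<nu> i k r *\<^sub>R row_fun n (C i) r)"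
    and H: "H = (\<lambda>i j. mat (ns i) (ns j) (\<lambda>(k, l). h i k j l))"
    and K: "K = (\<lambda>i j. mat (ns i) (s j) (\<lambda>(k, r). \<kappa> i k j r))"
    and M: "M = (\<lambda>i j. mat n (ns j) (\<lambda>(k, l). if j = i then \<mu> i k l else 0))"
    and N: "N = (\<lambda>i j. mat n (s j) (\<lambda>(k, r). if j = i then \<nu> i k r else 0))"
    and x: "\<And>t. t \<ge> 0 \<Longrightarrow> x t \<in> carrier_vec n" "\<And>t. t \<ge> 0 \<Longrightarrow> has_vec_deriv n x (A *\<^sub>v x t) t {0..}"
    and z: "\<And>i t. i < m \<Longrightarrow> t \<ge> 0 \<Longrightarrow> z i t \<in> carrier_vec (ns i)"
      "\<And>i t. i < m \<Longrightarrow> t \<ge> 0 \<Longrightarrow> has_vec_deriv (ns i) (z i)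
        (vsum (ns i) (\<lambda>j. H i j *\<^sub>v z j t + K i j *\<^sub>v (C j *\<^sub>v x t)) (Nb i)) t {0..}"
  shows "\<exists>c. \<forall>i < m. \<forall>t \<ge> 0.
      vnorm (vsum n (\<lambda>j. M i j *\<^sub>v z j t + N i j *\<^sub>v (C j *\<^sub>v x t)) (Nb i) - x t)
        \<le> c * mnorm (mat_exp t (block_mat ns ns m m H))"
proof -
  define \<epsilon> where "\<epsilon> i k t = z i t $ k - pairing n (T i k) (x t)" for i k t
  let ?S = "Sigma {..<m} (\<lambda>i. {..<ns i})" and ?\<phi> = "\<lambda>(i, k). offs ns i + k"
  let ?HM = "block_mat ns ns m m H" and ?L = "offs ns m"
  \<comment> \<open>The errors in flat indexing, to match the rows of the block matrix.\<close>
  define d where "d p = \<epsilon> (blk ns p) (p - offs ns (blk ns p))" for p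
  have HM: "?HM \<in> carrier_mat ?L ?L" by (rule block_mat_carrier)
  have finNb: "finite (Nb i)" if "i < m" for i using Nb(1)[OF that] finite_subset by blast
  have d\<phi>: "d (offs ns i + k) = \<epsilon> i k" if "k < ns i" for i k
    using that by (simp add: d_def blk_offs_add)
  have flat: "(\<Sum>p<?L. f p) = (\<Sum>j<m. \<Sum>l<ns j. f (offs ns j + l))" for f :: "nat \<Rightarrow> real"
    unfolding sum.reindex_bij_betw[OF bij_betw_offs[of ns m], symmetric]
    by (subst sum.Sigma) (auto intro!: sum.cong)
  have pair_sum: "pairing n (\<Sum>j\<in>J. G j) v = (\<Sum>j\<in>J. pairing n (G j) v)"
    for J :: "nat set" and G v
    by (simp add: linear_sum[OF linear_pairing])
  have pair_add: "pairing n (g + g') v = pairing n g v + pairing n g' v" for g g' v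
    by (simp add: linear_add[OF linear_pairing])
  have pair_scale: "pairing n (r *\<^sub>R g) v = r * pairing n g v" for r g v
    by (simp add: linear_scale[OF linear_pairing])
  have Cx: "(C j *\<^sub>v x t) $ r = pairing n (row_fun n (C j) r) (x t)"
    if "j < m" "r < s j" "t \<ge> 0" for j r t
    using pairing_row_fun[OF C[OF that(1)] x(1)[OF that(3)] that(2)] by simp
  have Cdim: "dim_vec (C j *\<^sub>v x t) = s j" if "j < m" for j t
    using C[OF that] by simp
  have d\<epsilon>: "(\<epsilon> i k has_real_derivative (\<Sum>j\<in>Nb i. \<Sum>l<ns j. h i k j l * \<epsilon> j l t)) (at t within {0..})"
    if i: "i < m" and k: "k < ns i" and t: "t \<ge> 0" for i k t
  proof -
    have "((\<lambda>t. z i t $ k) has_real_derivative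
        vsum (ns i) (\<lambda>j. H i j *\<^sub>v z j t + K i j *\<^sub>v (C j *\<^sub>v x t)) (Nb i) $ k) (at t within {0..})"
      using z(2)[OF i t] k unfolding has_vec_deriv_def by blast
    also have "vsum (ns i) (\<lambda>j. H i j *\<^sub>v z j t + K i j *\<^sub>v (C j *\<^sub>v x t)) (Nb i) $ k
        = (\<Sum>j\<in>Nb i. (\<Sum>l<ns j. h i k j l * z j t $ l)
            + (\<Sum>r<s j. \<kappa> i k j r * pairing n (row_fun n (C j) r) (x t)))"
      unfolding vsum_def index_vec[OF k]
    proof (rule sum.cong[OF refl])
      fix j assume "j \<in> Nb i"
      then have j: "j < m" using Nb(1)[OF i] by auto
      have "(H i j *\<^sub>v z j t) $ k = (\<Sum>l<ns j. h i k j l * z j t $ l)"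
        using k z(1)[OF j t] by (simp add: H index_mat_mult_vec del: index_mult_mat_vec)
      moreover have "(K i j *\<^sub>v (C j *\<^sub>v x t)) $ k = (\<Sum>r<s j. \<kappa> i k j r * (C j *\<^sub>v x t) $ r)"
        using k Cdim[OF j] by (simp add: K index_mat_mult_vec del: index_mult_mat_vec)
      moreover have "\<dots> = (\<Sum>r<s j. \<kappa> i k j r * pairing n (row_fun n (C j) r) (x t))"
        using Cx[OF j _ t] by (intro sum.cong) auto
      ultimately show "(H i j *\<^sub>v z j t + K i j *\<^sub>v (C j *\<^sub>v x t)) $ k
          = (\<Sum>l<ns j. h i k j l * z j t $ l)
            + (\<Sum>r<s j. \<kappa> i k j r * pairing n (row_fun n (C j) r) (x t))"
        using k by (simp add: K del: index_mult_mat_vec)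
    qed
    finally have dz: "((\<lambda>t. z i t $ k) has_real_derivative \<dots>) (at t within {0..})" .
    have "((\<lambda>t. pairing n (T i k) (x t)) has_real_derivative pairing n (T i k) (A *\<^sub>v x t)) (at t within {0..})"
      unfolding pairing_def using x(2)[OF t] unfolding has_vec_deriv_def
      by (intro DERIV_sum DERIV_cmult) auto
    also have "pairing n (T i k) (A *\<^sub>v x t) = pairing n (mult_fun n A (T i k)) (x t)"
      by (simp add: pairing_mult_fun[OF A x(1)[OF t]])
    also have "\<dots> = (\<Sum>j\<in>Nb i. (\<Sum>l<ns j. h i k j l * pairing n (T j l) (x t))
            + (\<Sum>r<s j. \<kappa> i k j r * pairing n (row_fun n (C j) r) (x t)))"
      unfolding dyn[OF i k] by (simp only: pair_add pair_sum pair_scale sum.distrib)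
    finally have dT: "((\<lambda>t. pairing n (T i k) (x t)) has_real_derivative \<dots>) (at t within {0..})" .
    have "(\<epsilon> i k has_real_derivative
        (\<Sum>j\<in>Nb i. (\<Sum>l<ns j. h i k j l * z j t $ l)
            + (\<Sum>r<s j. \<kappa> i k j r * pairing n (row_fun n (C j) r) (x t)))
        - (\<Sum>j\<in>Nb i. (\<Sum>l<ns j. h i k j l * pairing n (T j l) (x t))
            + (\<Sum>r<s j. \<kappa> i k j r * pairing n (row_fun n (C j) r) (x t)))) (at t within {0..})"
      unfolding \<epsilon>_def[abs_def] by (rule DERIV_diff[OF dz dT])
    then show ?thesis by (simp add: \<epsilon>_def sum.distrib sum_subtractf right_diff_distrib)
  qed
  have dd: "(d p has_real_derivative (\<Sum>c<?L. ?HM $$ (p, c) * d c t)) (at t within {0..})"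
    if p: "p < ?L" and t: "t \<ge> 0" for p t
  proof -
    obtain i k where ik: "i < m" "k < ns i" "p = offs ns i + k"
      using p by (rule offs_decompose)
    have "(\<Sum>c<?L. ?HM $$ (p, c) * d c t) = (\<Sum>j<m. \<Sum>l<ns j. h i k j l * \<epsilon> j l t)"
      unfolding flat using ik by (intro sum.cong) (auto simp: block_mat_entry d\<phi> H)
    \<comment> \<open>By \<open>sparse\<close>, agents outside the neighborhood contribute
      nothing.\<close>
    also have "\<dots> = (\<Sum>j\<in>Nb i. \<Sum>l<ns j. h i k j l * \<epsilon> j l t)"
      using Nb(1)[OF ik(1)] sparse[OF ik(1,2)] by (intro sum.mono_neutral_right) auto
    finally show ?thesis using d\<epsilon>[OF ik(1,2) t] by (simp add: ik d\<phi>)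
  qed
  have sol: "d p t = (\<Sum>c<?L. mat_exp t ?HM $$ (p, c) * d c 0)" if "p < ?L" "t \<ge> 0" for p t
    by (rule linear_ode_mat_exp[OF HM dd that])
  \<comment> \<open>The weights \<open>\<mu>\<close> of agent \<open>i\<close>, extended by 0 to the
    flat indices of other agents.\<close>
  define G where "G i k p = (if blk ns p = i then \<mu> i k (p - offs ns i) else 0)" for i k p
  define c where "c i = (\<Sum>k<n. \<Sum>p<?L. \<Sum>q<?L. \<bar>G i k p\<bar> * \<bar>d q 0\<bar>)" for i
  have c_nonneg: "c i \<ge> 0" for i unfolding c_def by (intro sum_nonneg) auto
  have bound: "vnorm (vsum n (\<lambda>j. M i j *\<^sub>v z j t + N i j *\<^sub>v (C j *\<^sub>v x t)) (Nb i) - x t)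
      \<le> c i * mnorm (mat_exp t ?HM)" if i: "i < m" and t: "t \<ge> 0" for i t
    unfolding c_def
  proof (rule vnorm_mat_exp_bound[OF HM])
    let ?v = "vsum n (\<lambda>j. M i j *\<^sub>v z j t + N i j *\<^sub>v (C j *\<^sub>v x t)) (Nb i) - x t"
    show "?v \<in> carrier_vec n" using carrier_vecD[OF x(1)[OF t]] by (intro carrier_vecI) simp
    fix k assume k: "k < n"
    have "?v $ k = (\<Sum>j\<in>Nb i. (M i j *\<^sub>v z j t + N i j *\<^sub>v (C j *\<^sub>v x t)) $ k) - x t $ k"
      using k x(1)[OF t] by (simp add: vsum_def)
    also have "(\<Sum>j\<in>Nb i. (M i j *\<^sub>v z j t + N i j *\<^sub>v (C j *\<^sub>v x t)) $ k)
        = (\<Sum>j\<in>Nb i. if j = i then (\<Sum>l<ns i. \<mu> i k l * z i t $ l)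
            + (\<Sum>r<s i. \<nu> i k r * pairing n (row_fun n (C i) r) (x t)) else 0)"
    proof (rule sum.cong[OF refl])
      fix j assume "j \<in> Nb i"
      then have j: "j < m" using Nb(1)[OF i] by auto
      have "(M i j *\<^sub>v z j t) $ k = (\<Sum>l<ns j. (if j = i then \<mu> i k l else 0) * z j t $ l)"
        using k z(1)[OF j t] by (simp add: M index_mat_mult_vec del: index_mult_mat_vec)
      moreover have "(N i j *\<^sub>v (C j *\<^sub>v x t)) $ k = (\<Sum>r<s j. (if j = i then \<nu> i k r else 0) * (C j *\<^sub>v x t) $ r)"
        using k Cdim[OF j] by (simp add: N index_mat_mult_vec del: index_mult_mat_vec)
      moreover have "\<dots> = (\<Sum>r<s j. (if j = i then \<nu> i k r else 0) * pairing n (row_fun n (C j) r) (x t))"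
        using Cx[OF j _ t] by (intro sum.cong) auto
      ultimately show "(M i j *\<^sub>v z j t + N i j *\<^sub>v (C j *\<^sub>v x t)) $ k
          = (if j = i then (\<Sum>l<ns i. \<mu> i k l * z i t $ l)
            + (\<Sum>r<s i. \<nu> i k r * pairing n (row_fun n (C i) r) (x t)) else 0)"
        using k by (auto simp: N simp del: index_mult_mat_vec)
    qed
    also have "\<dots> = (\<Sum>l<ns i. \<mu> i k l * z i t $ l)
            + (\<Sum>r<s i. \<nu> i k r * pairing n (row_fun n (C i) r) (x t))"
      using Nb(2)[OF i] finNb[OF i] by simp
    \<comment> \<open>Expanding the true state by the same reconstruction identity makes the output
      terms cancel.\<close>
    also have "x t $ k = pairing n (unit_fun k) (x t)" by (simp add: pairing_unit_fun k)
    also have "\<dots> = (\<Sum>l<ns i. \<mu> i k l * pairing n (T i l) (x t))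
            + (\<Sum>r<s i. \<nu> i k r * pairing n (row_fun n (C i) r) (x t))"
      unfolding recon[OF i k] by (simp only: pair_add pair_sum pair_scale)
    finally have "?v $ k = (\<Sum>l<ns i. \<mu> i k l * \<epsilon> i l t)"
      by (simp add: \<epsilon>_def right_diff_distrib sum_subtractf)
    also have "\<dots> = (\<Sum>j<m. \<Sum>l<ns j. if j = i then \<mu> i k l * \<epsilon> i l t else 0)"
    proof -
      have "(\<Sum>j<m. \<Sum>l<ns j. if j = i then \<mu> i k l * \<epsilon> i l t else 0)
          = (\<Sum>j<m. if j = i then (\<Sum>l<ns i. \<mu> i k l * \<epsilon> i l t) else 0)"
        by (intro sum.cong) auto
      then show ?thesis using i by simp
    qed
    also have "\<dots> = (\<Sum>p<?L. G i k p * d p t)"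
      unfolding flat by (intro sum.cong) (auto simp: G_def blk_offs_add d\<phi>)
    also have "\<dots> = (\<Sum>p<?L. G i k p * (\<Sum>c<?L. mat_exp t ?HM $$ (p, c) * d c 0))"
      using t by (intro sum.cong) (auto simp: sol[symmetric])
    finally show "?v $ k = (\<Sum>p<?L. G i k p * (\<Sum>c<?L. mat_exp t ?HM $$ (p, c) * d c 0))" .
  qed
  \<comment> \<open>The constants are nonnegative, so their sum serves all agents at once.\<close>
  have "c i * mnorm (mat_exp t ?HM) \<le> (\<Sum>i<m. c i) * mnorm (mat_exp t ?HM)" if "i < m" for i t
    using that c_nonneg by (intro mult_right_mono member_le_sum mnorm_nonneg) auto
  then show ?thesis using bound order_trans by (intro exI[of _ "\<Sum>i<m. c i"]) blast
qed

theorem theorem1: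
  fixes m n :: nat
    and A :: "real mat"
    and s :: "nat \<Rightarrow> nat"
    and C :: "nat \<Rightarrow> real mat"
    and Nb :: "nat \<Rightarrow> nat set"
    and \<Lambda> :: "complex multiset"
  assumes m1: "m \<ge> 1" and n1: "n \<ge> 1"
    and A_dim: "A \<in> carrier_mat n n"
    and C_dim: "\<And>i. i < m \<Longrightarrow> C i \<in> carrier_mat (s i) n"
    and C_nz: "\<And>i. i < m \<Longrightarrow> C i \<noteq> 0\<^sub>m (s i) n"
    and joint_obs: "observable (block_mat s (\<lambda>_. n) m 1 (\<lambda>i j. C i)) A"
    and Nb_sub: "\<And>i. i < m \<Longrightarrow> Nb i \<subseteq> {..<m}"
    and Nb_self: "\<And>i. i < m \<Longrightarrow> i \<in> Nb i"
    and sc: "strongly_connected m Nb"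
    and Lsize: "size \<Lambda> = m * n + m - 1"
    and Lsym: "image_mset cnj \<Lambda> = \<Lambda>"
  shows "\<exists>(ns :: nat \<Rightarrow> nat) (H :: nat \<Rightarrow> nat \<Rightarrow> real mat) (K :: nat \<Rightarrow> nat \<Rightarrow> real mat)
           (M :: nat \<Rightarrow> nat \<Rightarrow> real mat) (N :: nat \<Rightarrow> nat \<Rightarrow> real mat).
     (\<Sum>i<m. ns i) = m * n + m - 1 \<and>
     (\<forall>i < m. \<forall>j < m.
        H i j \<in> carrier_mat (ns i) (ns j) \<and> K i j \<in> carrier_mat (ns i) (s j) \<and>
        M i j \<in> carrier_mat n (ns j) \<and> N i j \<in> carrier_mat n (s j) \<and>
        (j \<notin> Nb i \<longrightarrow> H i j = 0\<^sub>m (ns i) (ns j))) \<and>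
     char_poly (map_mat complex_of_real (block_mat ns ns m m H))
        = (\<Prod>a\<in>#\<Lambda>. [:- a, 1:]) \<and>
     (\<forall>(x :: real \<Rightarrow> real vec) (z :: nat \<Rightarrow> real \<Rightarrow> real vec).
        (\<forall>t \<ge> 0. x t \<in> carrier_vec n \<and> has_vec_deriv n x (A *\<^sub>v x t) t {0..}) \<and>
        (\<forall>i < m. \<forall>t \<ge> 0. z i t \<in> carrier_vec (ns i) \<and>
           has_vec_deriv (ns i) (z i)
             (vsum (ns i) (\<lambda>j. H i j *\<^sub>v z j t + K i j *\<^sub>v (C j *\<^sub>v x t)) (Nb i)) t {0..})
        \<longrightarrow> (\<exists>c. \<forall>i < m. \<forall>t \<ge> 0.
              vnorm (vsum n (\<lambda>j. M i j *\<^sub>v z j t + N i j *\<^sub>v (C j *\<^sub>v x t)) (Nb i) - x t)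
                \<le> c * mnorm (mat_exp t (block_mat ns ns m m H))))"
proof -
  \<comment> \<open>Instance of the abstract construction: functionals are functions on indices
    below \<open>n\<close>, and \<open>?a\<close> is right multiplication by
    \<open>A\<close>.\<close>
  let ?a = "mult_fun n A" and ?c = "\<lambda>j r. row_fun n (C j) r" and ?B = "unit_fun ` {..<n}"
  have card: "card ?B \<le> n" using card_image_le[of "{..<n}" unit_fun] by simp
  have nz: "\<exists>r<s i. ?c i r \<noteq> 0" if i: "i < m" for i
  proof (rule ccontr)
    assume "\<not> ?thesis"
    then have "?c i r l = 0" if "r < s i" for r l using that by auto
    then have "C i $$ (r, l) = 0" if "r < s i" "l < n" for r l
      using that by (metis row_fun_def)
    then have "C i = 0\<^sub>m (s i) n" using C_dim[OF i] by (intro eq_matI) auto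
    then show False using C_nz[OF i] by simp
  qed
  obtain ns :: "nat \<Rightarrow> nat" and h \<kappa> :: "nat \<Rightarrow> nat \<Rightarrow> nat \<Rightarrow> nat \<Rightarrow> real" and T :: "nat \<Rightarrow> nat \<Rightarrow> nat \<Rightarrow> real" where
    ns: "(\<Sum>i<m. ns i) = m * n + m - 1" and
    sparse: "\<And>i k j l. i < m \<Longrightarrow> k < ns i \<Longrightarrow> j \<notin> Nb i \<Longrightarrow> h i k j l = 0" and
    dyn: "\<And>i k. i < m \<Longrightarrow> k < ns i \<Longrightarrow> ?a (T i k)
      = (\<Sum>j\<in>Nb i. \<Sum>l<ns j. h i k j l *\<^sub>R T j l) + (\<Sum>j\<in>Nb i. \<Sum>r<s j. \<kappa> i k j r *\<^sub>R ?c j r)" and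
    full: "\<And>i. i < m \<Longrightarrow> span ?B \<subseteq> span (T i ` {..<ns i} \<union> ?c i ` {..<s i})" and
    det: "fdet (Sigma {..<m} (\<lambda>i. {..<ns i}))
      (\<lambda>(i, k) (j, l). (if (i, k) = (j, l) then [:0, 1:] else 0) - [:complex_of_real (h i k j l):])
      = (\<Prod>a\<in>#\<Lambda>. [:- a, 1:])"
    by (rule distributed_observer_functionals[OF linear_mult_fun _ card
          observable_span[OF A_dim C_dim joint_obs] nz m1 Nb_sub Nb_self sc Lsize Lsym])
      auto
  \<comment> \<open>Naming the identity keeps it opaque while the coefficient functions are chosen;
    it is unfolded again for \<open>bound\<close>.\<close>
  define recon where "recon i k \<mu> \<nu> \<longleftrightarrow> unit_fun k
      = (\<Sum>l<ns i. \<mu> l *\<^sub>R T i l) + (\<Sum>r<s i. \<nu> r *\<^sub>R ?c i r)" for i k \<mu> \<nu>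
  have "\<exists>\<mu> \<nu>. recon i k \<mu> \<nu>" if "i < m" "k < n" for i k
  proof -
    have "unit_fun k \<in> span (T i ` {..<ns i} \<union> ?c i ` {..<s i})"
      using full[OF that(1)] that(2) by (auto intro: span_base)
    then obtain u v where uv: "unit_fun k = u + v" "u \<in> span (T i ` {..<ns i})" "v \<in> span (?c i ` {..<s i})"
      unfolding span_Un by auto
    obtain \<mu> where "u = (\<Sum>l<ns i. \<mu> l *\<^sub>R T i l)" using span_image_sum[OF finite_lessThan uv(2)] by blast
    moreover obtain \<nu> where "v = (\<Sum>r<s i. \<nu> r *\<^sub>R ?c i r)" using span_image_sum[OF finite_lessThan uv(3)] by blast
    ultimately show ?thesis using uv(1) unfolding recon_def by auto
  qed
  then obtain \<mu> \<nu> where recon: "\<And>i k. i < m \<Longrightarrow> k < n \<Longrightarrow> recon i k (\<mu> i k) (\<nu> i k)"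
    by metis
  define H where "H = (\<lambda>i j. mat (ns i) (ns j) (\<lambda>(k, l). h i k j l))"
  define K where "K = (\<lambda>i j. mat (ns i) (s j) (\<lambda>(k, r). \<kappa> i k j r))"
  \<comment> \<open>The readout uses only the agent's own state and output; neighbors enter only
    through the dynamics of \<open>z\<close>.\<close>
  define M where "M = (\<lambda>i j. mat n (ns j) (\<lambda>(k, l). if j = i then \<mu> i k l else 0))"
  define N where "N = (\<lambda>i j. mat n (s j) (\<lambda>(k, r). if j = i then \<nu> i k r else 0))"
  have "H i j = 0\<^sub>m (ns i) (ns j)" if "i < m" "j \<notin> Nb i" for i j
    using sparse that by (intro eq_matI) (auto simp: H_def)
  then have dims: "\<forall>i < m. \<forall>j < m.
        H i j \<in> carrier_mat (ns i) (ns j) \<and> K i j \<in> carrier_mat (ns i) (s j) \<and>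
        M i j \<in> carrier_mat n (ns j) \<and> N i j \<in> carrier_mat n (s j) \<and>
        (j \<notin> Nb i \<longrightarrow> H i j = 0\<^sub>m (ns i) (ns j))"
    by (auto simp: H_def K_def M_def N_def)
  have charpoly: "char_poly (map_mat complex_of_real (block_mat ns ns m m H)) = (\<Prod>a\<in>#\<Lambda>. [:- a, 1:])"
    unfolding det[symmetric] by (rule char_poly_block_mat) (simp add: H_def)
  note bound = observer_error_bound[where h = h and \<kappa> = \<kappa> and T = T and \<mu> = \<mu> and \<nu> = \<nu>,
      OF A_dim C_dim Nb_sub Nb_self sparse dyn recon[unfolded recon_def] H_def K_def M_def N_def]
  show ?thesis
    by (intro exI[of _ ns] exI[of _ H] exI[of _ K] exI[of _ M] exI[of _ N] conjI allI impI)
      (use ns dims charpoly in \<open>auto intro!: bound\<close>)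
qed

end
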